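(* There are absolute constants $C$ and $p_0$ such that the following holds for every prime $p\ge p_0$. Let $A$ be an incomplete subset of $\mathbf{Z}_p$ of size at least $1.99\, p^{1/2}$. Then there is some non-zero element $b \in \mathbf{Z}_p$ such that $$\sum_{a \in bA} \|a\| \le p + C p^{1/2}.$$
   Context: $\mathbf{Z}_p$ is the field of integers modulo the prime $p$. For $x\in\mathbf{Z}_p$, the norm $\|x\|$ is the distance from $x$ to $0$, i.e. $\|x\|=\min(x,p-x)$ for the representative $x\in\{0,\dots,p-1\}$. $bA=\{ba : a\in A\}$. For $A \subset \mathbf{Z}_p$, $S_A = \{\sum_{x \in B} x : \emptyset \ne B \subset A\}$ is the set of sums of distinct elements of $A$ over non-empty subsets, and $A$ is incomplete if $S_A\neq\mathbf{Z}_p$. *)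

theory Defs
  imports Complex_Main "HOL-Number_Theory.Residues"
begin

abbreviation Zp :: "nat \<Rightarrow> int ring" where
  "Zp p \<equiv> residue_ring (int p)"

definition subset_sums :: "nat \<Rightarrow> int set \<Rightarrow> int set" where
  "subset_sums p A = {finsum (Zp p) (\<lambda>x. x) B | B. B \<noteq> {} \<and> B \<subseteq> A}"

definition incomplete :: "nat \<Rightarrow> int set \<Rightarrow> bool" where
  "incomplete p A \<longleftrightarrow> subset_sums p A \<noteq> carrier (Zp p)"

definition dilate :: "nat \<Rightarrow> int \<Rightarrow> int set \<Rightarrow> int set" where
  "dilate p b A = (\<lambda>a. b \<otimes>\<^bsub>Zp p\<^esub> a) ` A"

(* Only meant for x in the carrier of Zp p, i.e. for representatives 0 <= x <= p - 1. *)
definition Zp_norm :: "nat \<Rightarrow> int \<Rightarrow> int" where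
  "Zp_norm p x = min x (int p - x)"

end

theory Submission
  imports Defs
begin

text \<open>
  For a set \<open>S\<close> of residues let \<open>\<lambda>(x)\<close> be the number of \<open>s \<in> S\<close> with \<open>s + x \<notin> S\<close>; this is
  subadditive and even, and adjoining \<open>x\<close> to a set with subset sums \<open>S\<close> adds \<open>\<lambda>(x)\<close> new sums.
  By Cauchy--Davenport about \<open>2 k\<close> residues at most satisfy \<open>\<lambda> \<le> k\<close>, so adding greedily the
  element of largest \<open>\<lambda>\<close> gains at least about half the number of remaining elements at each step.
  With \<open>N\<close> close to \<open>1.99 \<surd>p\<close> elements this already gives almost \<open>N\<^sup>2 / 4 \<ge> 0.98 p\<close> sums, so
  incompleteness forces an early step at which the gain \<open>k\<close> is at most \<open>0.6\<close> times the number \<open>\<rho>\<close>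
  of remaining elements, all of which then satisfy \<open>\<lambda> \<le> k\<close>.

  At that step \<open>S\<close> has positive density, and Plancherel yields a dilation taking all but \<open>O(1)\<close> of
  the remaining elements into \<open>[-p/100, p/100]\<close>. Their 40-fold sumset, now a set of integers, lies in
  \<open>{\<lambda> \<le> 40 k}\<close> and so has at most \<open>49 \<rho>\<close> elements. Hence they are multiples of some \<open>d\<close> inside
  \<open>[-d M, d M]\<close> with \<open>M \<le> (49 / 77) \<rho>\<close>, and after dividing by \<open>d\<close> both their positive and their
  negative parts have density above one half. The subset sums of such a set fill its whole range
  up to \<open>O(M)\<close> at both ends, an interval longer than \<open>p / 2\<close>; every further element,
  represented in \<open>[-p/2, p/2]\<close>, lengthens the interval by its norm. As the interval is shorter than
  \<open>p\<close>, the sum of norms is at most \<open>p + O(M)\<close>.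
\<close>

subsection \<open>Periodic sets of integers and the Cauchy--Davenport theorem\<close>

text \<open>Sets of residues are encoded as periodic sets of integers, so that translates, dilates
  and sums are formed in the integers without reduction. The period varies: it is the prime at
  first, and the largest element of a set of integers in \<open>nfold_structure\<close>.\<close>

definition periodic :: "int \<Rightarrow> int set \<Rightarrow> bool" where
  "periodic p S \<longleftrightarrow> (\<forall>x. x + p \<in> S \<longleftrightarrow> x \<in> S)"

definition rcard :: "int \<Rightarrow> int set \<Rightarrow> nat" where
  "rcard p S = card (S \<inter> {0..<p})"

definition lam :: "int \<Rightarrow> int set \<Rightarrow> int \<Rightarrow> nat" where
  "lam p S x = rcard p {s \<in> S. s + x \<notin> S}"

lemma periodic_add_mult:
  assumes "periodic p S"
  shows "x + p * k \<in> S \<longleftrightarrow> x \<in> S"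
proof (induction k rule: int_induct[where k = 0])
  case (step1 i)
  have "x + p * (i + 1) = x + p * i + p" by (simp add: algebra_simps)
  then show ?case using step1 assms unfolding periodic_def by metis
next
  case (step2 i)
  have "x + p * i = x + p * (i - 1) + p" by (simp add: algebra_simps)
  then show ?case using step2 assms unfolding periodic_def by metis
qed simp

lemma periodic_cong:
  assumes "periodic p S" "[x = y] (mod p)"
  shows "x \<in> S \<longleftrightarrow> y \<in> S"
proof -
  obtain k where "y = x + p * k" using assms(2) by (auto simp: cong_iff_lin)
  then show ?thesis using periodic_add_mult[OF assms(1)] by simp
qed

lemma periodic_mod: "periodic p S \<Longrightarrow> x mod p \<in> S \<longleftrightarrow> x \<in> S"
  by (erule periodic_cong) (simp add: cong_def)

lemma periodicI: "(\<And>x. x + p \<in> S \<longleftrightarrow> x \<in> S) \<Longrightarrow> periodic p S"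
  by (simp add: periodic_def)

lemma periodic_affine:
  assumes "periodic p S"
  shows "periodic p {x. u * x + a \<in> S}"
proof (rule periodicI)
  fix x
  show "(x + p \<in> {x. u * x + a \<in> S}) = (x \<in> {x. u * x + a \<in> S})"
    using periodic_add_mult[OF assms, of "u * x + a" u] by (simp add: algebra_simps)
qed

lemma periodic_translate: "periodic p S \<Longrightarrow> periodic p {x. x + a \<in> S}"
  using periodic_affine[of p S 1 a] by simp

lemma periodic_Int: "periodic p S \<Longrightarrow> periodic p T \<Longrightarrow> periodic p (S \<inter> T)"
  and periodic_Un: "periodic p S \<Longrightarrow> periodic p T \<Longrightarrow> periodic p (S \<union> T)"
  and periodic_Diff: "periodic p S \<Longrightarrow> periodic p T \<Longrightarrow> periodic p (S - T)"
  and periodic_Compl: "periodic p S \<Longrightarrow> periodic p (- S)"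
  by (auto simp: periodic_def)

lemma rcard_mono: "S \<subseteq> T \<Longrightarrow> rcard p S \<le> rcard p T"
  unfolding rcard_def by (intro card_mono) auto

lemma rcard_le: "0 < p \<Longrightarrow> rcard p S \<le> nat p"
  using rcard_mono[of S UNIV p] by (simp add: rcard_def)

lemma rcard_Un_Int: "rcard p S + rcard p T = rcard p (S \<union> T) + rcard p (S \<inter> T)"
proof -
  have "(S \<union> T) \<inter> {0..<p} = (S \<inter> {0..<p}) \<union> (T \<inter> {0..<p})"
    "(S \<inter> T) \<inter> {0..<p} = (S \<inter> {0..<p}) \<inter> (T \<inter> {0..<p})" by auto
  then show ?thesis
    unfolding rcard_def by (simp only:) (rule card_Un_Int; simp)
qed

lemma rcard_Un_disjoint: "S \<inter> T = {} \<Longrightarrow> rcard p (S \<union> T) = rcard p S + rcard p T"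
  using rcard_Un_Int[of p S T] by (simp add: rcard_def)

lemma rcard_split: "rcard p S = rcard p {s \<in> S. P s} + rcard p {s \<in> S. \<not> P s}"
proof -
  have "rcard p ({s \<in> S. P s} \<union> {s \<in> S. \<not> P s}) = rcard p {s \<in> S. P s} + rcard p {s \<in> S. \<not> P s}"
    by (rule rcard_Un_disjoint) auto
  moreover have "{s \<in> S. P s} \<union> {s \<in> S. \<not> P s} = S" by auto
  ultimately show ?thesis by simp
qed

lemma rcard_Compl: "0 < p \<Longrightarrow> rcard p S + rcard p (- S) = nat p"
  using rcard_Un_Int[of p S "- S"] by (simp add: rcard_def)

text \<open>The inverse map is \<open>y \<mapsto> v * (y - a)\<close>; reduced modulo
  \<open>p\<close>, both maps become bijections between the sets of representatives.\<close>

lemma rcard_affine: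
  assumes p: "0 < p" and S: "periodic p S" and uv: "[u * v = 1] (mod p)"
  shows "rcard p {x. u * x + a \<in> S} = rcard p S"
proof -
  have vu: "[v * (u * x + a - a) = x] (mod p)" for x
    using cong_mult[OF uv cong_refl[of x]] by (simp add: ac_simps)
  have forth: "[u * (v * (y - a)) + a = y] (mod p)" for y
    using cong_add[OF cong_mult[OF uv cong_refl[of "y - a"]] cong_refl[of a]] by (simp add: ac_simps)
  have "bij_betw (\<lambda>x. (u * x + a) mod p) ({x. u * x + a \<in> S} \<inter> {0..<p}) (S \<inter> {0..<p})"
  proof (rule bij_betwI[where g = "\<lambda>y. (v * (y - a)) mod p"])
    show "(\<lambda>x. (u * x + a) mod p) \<in> {x. u * x + a \<in> S} \<inter> {0..<p} \<rightarrow> S \<inter> {0..<p}"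
      using p S by (auto simp: periodic_mod)
    show "(\<lambda>y. v * (y - a) mod p) \<in> S \<inter> {0..<p} \<rightarrow> {x. u * x + a \<in> S} \<inter> {0..<p}"
    proof
      fix y assume y: "y \<in> S \<inter> {0..<p}"
      have "[u * (v * (y - a) mod p) + a = u * (v * (y - a)) + a] (mod p)"
        by (intro cong_add cong_mult cong_refl) (simp add: cong_def)
      then have "[u * (v * (y - a) mod p) + a = y] (mod p)"
        using forth cong_trans by blast
      then show "v * (y - a) mod p \<in> {x. u * x + a \<in> S} \<inter> {0..<p}"
        using y p periodic_cong[OF S] by auto
    qed
    show "v * ((u * x + a) mod p - a) mod p = x" if "x \<in> {x. u * x + a \<in> S} \<inter> {0..<p}" for x
    proof -
      have "[v * ((u * x + a) mod p - a) = v * (u * x + a - a)] (mod p)"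
        by (intro cong_diff cong_mult cong_refl) (simp add: cong_def)
      then show ?thesis using vu[of x] that unfolding cong_def by simp
    qed
    show "(u * (v * (y - a) mod p) + a) mod p = y" if "y \<in> S \<inter> {0..<p}" for y
    proof -
      have "[u * (v * (y - a) mod p) + a = u * (v * (y - a)) + a] (mod p)"
        by (intro cong_add cong_mult cong_refl) (simp add: cong_def)
      then show ?thesis using forth[of y] that unfolding cong_def by simp
    qed
  qed
  then show ?thesis unfolding rcard_def by (rule bij_betw_same_card)
qed

lemma rcard_translate: "0 < p \<Longrightarrow> periodic p S \<Longrightarrow> rcard p {x. x + a \<in> S} = rcard p S"
  using rcard_affine[of p S 1 1 a] by simp

lemma periodic_lam_set:
  assumes "periodic p S"
  shows "periodic p {s \<in> S. s + x \<notin> S}"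
proof -
  have "{s \<in> S. s + x \<notin> S} = S - {s. s + x \<in> S}" by auto
  then show ?thesis using periodic_Diff[OF assms periodic_translate[OF assms]] by simp
qed

lemma lam_eq:
  assumes "0 < p" "periodic p S"
  shows "lam p S x + rcard p {s \<in> S. s + x \<in> S} = rcard p S"
  using rcard_split[of p S "\<lambda>s. s + x \<in> S"] by (simp add: lam_def)

lemma lam_cong: "periodic p S \<Longrightarrow> [x = y] (mod p) \<Longrightarrow> lam p S x = lam p S y"
proof -
  assume S: "periodic p S" and xy: "[x = y] (mod p)"
  have "s + x \<in> S \<longleftrightarrow> s + y \<in> S" for s
    by (rule periodic_cong[OF S]) (intro cong_add cong_refl xy)
  then show ?thesis unfolding lam_def by (simp only:)
qed

text \<open>If \<open>s\<close> lies in \<open>S\<close> and \<open>s + x + y\<close> does not, then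
  either \<open>x\<close> already moves \<open>s\<close> out of \<open>S\<close>, or
  \<open>s + x\<close> is an element of \<open>S\<close> that \<open>y\<close> moves out.\<close>

lemma lam_add_le:
  assumes p: "0 < p" and S: "periodic p S"
  shows "lam p S (x + y) \<le> lam p S x + lam p S y"
proof -
  let ?A = "{s \<in> S. s + x \<notin> S}" and ?B = "{s. s + x \<in> {s \<in> S. s + y \<notin> S}}"
  have "lam p S (x + y) \<le> rcard p (?A \<union> ?B)"
    unfolding lam_def by (rule rcard_mono) (auto simp: ac_simps)
  also have "\<dots> \<le> rcard p ?A + rcard p ?B"
    using rcard_Un_Int[of p ?A ?B] by linarith
  also have "rcard p ?B = lam p S y"
    unfolding lam_def by (rule rcard_translate[OF p periodic_lam_set[OF S]])
  finally show ?thesis by (simp add: lam_def)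
qed

text \<open>Translation by \<open>x\<close> carries the overlap of \<open>S\<close> with its shift
  by \<open>x\<close> onto the overlap for \<open>- x\<close>, so the two overlaps have the same
  size.\<close>

lemma lam_uminus:
  assumes p: "0 < p" and S: "periodic p S"
  shows "lam p S (- x) = lam p S x"
proof -
  have per: "periodic p {s \<in> S. s + x \<in> S}"
    using periodic_Int[OF S periodic_translate[OF S, of x]] by (simp add: Int_def)
  have "rcard p {s \<in> S. s + - x \<in> S} = rcard p {s. s + - x \<in> {s \<in> S. s + x \<in> S}}"
    by (rule arg_cong[where f = "rcard p"]) auto
  also have "\<dots> = rcard p {s \<in> S. s + x \<in> S}" by (rule rcard_translate[OF p per])
  finally show ?thesis using lam_eq[OF p S, of x] lam_eq[OF p S, of "- x"] by linarith
qed

lemma lam_zero [simp]: "lam p S 0 = 0"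
proof -
  have "{s \<in> S. s + 0 \<notin> S} = {}" by simp
  then show ?thesis unfolding lam_def rcard_def by simp
qed

text \<open>A point of the complement that \<open>x\<close> moves into \<open>S\<close> is, read
  backwards, a point of \<open>S\<close> that \<open>- x\<close> moves out.\<close>

lemma lam_Compl:
  assumes p: "0 < p" and S: "periodic p S"
  shows "lam p (- S) x = lam p S x"
proof -
  have "lam p (- S) x = rcard p {s. s + x \<in> {t \<in> S. t + - x \<notin> S}}"
    unfolding lam_def by (rule arg_cong[where f = "rcard p"]) auto
  also have "\<dots> = lam p S (- x)"
    unfolding lam_def by (rule rcard_translate[OF p periodic_lam_set[OF S]])
  finally show ?thesis using lam_uminus[OF p S] by simp
qed

text \<open>Double counting: each ordered pair of residues in \<open>S\<close> occurs for exactly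
  one difference \<open>x\<close>.\<close>

lemma sum_rcard_overlap:
  assumes p: "0 < p" and S: "periodic p S"
  shows "(\<Sum>x\<in>{0..<p}. rcard p {s \<in> S. s + x \<in> S}) = (rcard p S)\<^sup>2"
proof -
  let ?I = "{0..<p}"
  have "rcard p {s \<in> S. s + x \<in> S} = (\<Sum>s\<in>S \<inter> ?I. if s + x \<in> S then 1 else 0)" for x
  proof -
    have "{s \<in> S. s + x \<in> S} \<inter> ?I = S \<inter> ?I \<inter> {s. s + x \<in> S}" by auto
    then show ?thesis unfolding rcard_def by (simp add: sum.If_cases)
  qed
  then have "(\<Sum>x\<in>?I. rcard p {s \<in> S. s + x \<in> S}) = (\<Sum>x\<in>?I. \<Sum>s\<in>S \<inter> ?I. if s + x \<in> S then 1 else 0)"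
    by simp
  also have "\<dots> = (\<Sum>s\<in>S \<inter> ?I. \<Sum>x\<in>?I. if s + x \<in> S then 1 else 0)" by (rule sum.swap)
  also have "\<dots> = (\<Sum>s\<in>S \<inter> ?I. rcard p {x. x + s \<in> S})"
  proof (intro sum.cong refl)
    fix s
    have "{x. x + s \<in> S} \<inter> ?I = ?I \<inter> {x. s + x \<in> S}" by (auto simp: add.commute)
    then show "(\<Sum>x\<in>?I. if s + x \<in> S then 1 else 0) = rcard p {x. x + s \<in> S}"
      unfolding rcard_def by (simp add: sum.If_cases)
  qed
  also have "\<dots> = (\<Sum>s\<in>S \<inter> ?I. rcard p S)" using rcard_translate[OF p S] by simp
  also have "\<dots> = (rcard p S)\<^sup>2" by (simp add: rcard_def power2_eq_square)
  finally show ?thesis .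
qed

section \<open>Sumsets and the Cauchy--Davenport theorem\<close>

definition sumset :: "int set \<Rightarrow> int set \<Rightarrow> int set" where
  "sumset A B = {a + b | a b. a \<in> A \<and> b \<in> B}"

lemma rcard_eq_full:
  assumes "0 < p" "periodic p S" "rcard p S = nat p"
  shows "S = UNIV"
proof -
  have "S \<inter> {0..<p} = {0..<p}"
    using assms by (intro card_subset_eq) (auto simp: rcard_def)
  then have "x \<in> S" for x
  proof -
    have "x mod p \<in> S \<inter> {0..<p}"
      unfolding \<open>S \<inter> {0..<p} = {0..<p}\<close> using assms(1) by simp
    then show ?thesis using periodic_mod[OF assms(2)] by simp
  qed
  then show ?thesis by auto
qed

lemma rcard_pos:
  assumes "0 < p" "periodic p S" "x \<in> S"
  shows "0 < rcard p S"
proof -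
  have "x mod p \<in> S \<inter> {0..<p}" using assms periodic_mod by simp
  then show ?thesis unfolding rcard_def by (auto simp: card_gt_0_iff)
qed

lemma rcard_zeroD: "0 < p \<Longrightarrow> periodic p S \<Longrightarrow> rcard p S = 0 \<Longrightarrow> S = {}"
  by (metis rcard_pos all_not_in_conv less_irrefl)

text \<open>As \<open>d\<close> is invertible modulo \<open>p\<close>, the progression
  \<open>a, a + d, a + 2 * d, ...\<close> meets every residue class.\<close>

lemma closed_under_shift_UNIV:
  assumes p: "prime (p::int)" and S: "periodic p S" and d: "\<not> p dvd d"
    and a: "a \<in> S" and step: "\<And>x. x \<in> S \<Longrightarrow> x + d \<in> S"
  shows "S = UNIV"
proof -
  have iter: "a + int n * d \<in> S" for n
  proof (induction n)
    case (Suc n)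
    have eq: "a + int (Suc n) * d = (a + int n * d) + d" by (simp add: algebra_simps)
    show ?case unfolding eq by (rule step[OF Suc])
  qed (use a in simp)
  have "x \<in> S" for x
  proof -
    have "coprime d p" using p d by (metis coprime_commute prime_imp_coprime)
    then obtain e where e: "[d * e = 1] (mod p)" using coprime_iff_invertible_int by blast
    let ?n = "nat ((e * (x - a)) mod p)"
    have n: "int ?n = (e * (x - a)) mod p" using prime_gt_0_int[OF p] by simp
    have "[a + int ?n * d = a + (d * e) * (x - a)] (mod p)"
    proof -
      have "[a + (e * (x - a)) mod p * d = a + (e * (x - a)) * d] (mod p)"
        by (intro cong_add cong_mult cong_refl) (simp add: cong_def)
      then show ?thesis unfolding n by (simp add: ac_simps)
    qed
    moreover have "[a + (d * e) * (x - a) = a + 1 * (x - a)] (mod p)"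
      by (intro cong_add cong_mult e cong_refl)
    ultimately have "[a + int ?n * d = x] (mod p)" by (simp add: cong_def)
    then show ?thesis using iter periodic_cong[OF S] by blast
  qed
  then show ?thesis by auto
qed

lemma cauchy_davenport:
  assumes p: "prime (p::int)" and "periodic p A" "periodic p B" "A \<noteq> {}" "B \<noteq> {}"
  shows "min (nat p) (rcard p A + rcard p B - 1) \<le> rcard p (sumset A B)"
  using assms(2-5)
proof (induction "rcard p B" arbitrary: A B rule: less_induct)
  case less
  have p0: "0 < p" using prime_gt_0_int[OF p] .
  note perA = less.prems(1) and perB = less.prems(2)
  obtain b where b: "b \<in> B" using less.prems by auto
  have sub: "{x. x + (- b) \<in> A} \<subseteq> sumset A B"
  proof
    fix x assume "x \<in> {x. x + (- b) \<in> A}"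
    then have "x - b \<in> A" "x = (x - b) + b" by auto
    then show "x \<in> sumset A B" using b unfolding sumset_def by blast
  qed
  have A_le: "rcard p A \<le> rcard p (sumset A B)"
    using rcard_mono[OF sub, of p] rcard_translate[OF p0 perA, of "- b"] by linarith
  consider "A = UNIV" | "\<forall>x\<in>B. p dvd x - b" | b' where "A \<noteq> UNIV" "b' \<in> B" "\<not> p dvd b' - b"
    by blast
  then show ?case
  proof cases
    case 1
    then show ?thesis using A_le by (simp add: rcard_def)
  next
    case 2
    have "rcard p B \<le> card {b mod p}"
      unfolding rcard_def
    proof (rule card_mono)
      show "B \<inter> {0..<p} \<subseteq> {b mod p}"
      proof
        fix x assume x: "x \<in> B \<inter> {0..<p}"
        then have "p dvd x - b" using 2 by simp
        then have "x mod p = b mod p" by (simp only: mod_eq_dvd_iff)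
        moreover have "x mod p = x" using x by simp
        ultimately show "x \<in> {b mod p}" by simp
      qed
    qed simp
    then show ?thesis using A_le by simp
  next
    case 3
    obtain a0 where "a0 \<in> A" using less.prems by auto
    then obtain a where a: "a \<in> A" "a + (b' - b) \<notin> A"
      using closed_under_shift_UNIV[OF p perA 3(3), of a0] 3(1) by blast
    \<comment> \<open>Dyson's transform: \<open>A\<close> grows by the translate of \<open>B\<close>
      by \<open>e\<close>, and \<open>B\<close> shrinks to the points that \<open>e\<close> moves
      into \<open>A\<close>. The total size is kept and the sumset does not grow. \<open>b\<close>
      survives since \<open>b + e = a\<close>, while \<open>b'\<close> is lost since
      \<open>b' + e\<close> is outside \<open>A\<close>; so the induction on the size of
      \<open>B\<close> applies.\<close>
    define e where "e = a - b"
    let ?A = "A \<union> {x. x + (- e) \<in> B}" and ?B = "B \<inter> {x. x + e \<in> A}"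
    have perB': "periodic p ?B" by (rule periodic_Int[OF perB periodic_translate[OF perA]])
    have perA': "periodic p ?A" by (rule periodic_Un[OF perA periodic_translate[OF perB]])
    have bB: "b \<in> ?B" using a b by (simp add: e_def)
    have b'B: "b' \<notin> {x. x + e \<in> A}" using a by (simp add: e_def algebra_simps)
    have lt: "rcard p ?B < rcard p B"
      unfolding rcard_def
    proof (rule psubset_card_mono)
      have "b' mod p \<in> B" using 3(2) by (simp add: periodic_mod[OF perB])
      moreover have "b' mod p \<notin> {x. x + e \<in> A}"
        using b'B by (subst periodic_mod[OF periodic_translate[OF perA]])
      moreover have "b' mod p \<in> {0..<p}" using p0 by simp
      ultimately show "?B \<inter> {0..<p} \<subset> B \<inter> {0..<p}" by blast
    qed simp
    have IH: "min (nat p) (rcard p ?A + rcard p ?B - 1) \<le> rcard p (sumset ?A ?B)"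
      by (rule less.hyps[OF lt perA' perB']) (use a bB in blast)+
    have sub: "sumset ?A ?B \<subseteq> sumset A B"
    proof
      fix x assume "x \<in> sumset ?A ?B"
      then obtain u v where uv: "u \<in> ?A" "v \<in> ?B" "x = u + v" unfolding sumset_def by blast
      show "x \<in> sumset A B"
      proof (cases "u \<in> A")
        case True then show ?thesis using uv unfolding sumset_def by blast
      next
        case False
        then have "x = (v + e) + (u + (- e))" "v + e \<in> A" "u + (- e) \<in> B" using uv by auto
        then show ?thesis unfolding sumset_def by blast
      qed
    qed
    have "rcard p A + rcard p {x. x + (- e) \<in> B} = rcard p ?A + rcard p (A \<inter> {x. x + (- e) \<in> B})"
      by (rule rcard_Un_Int)
    moreover have "rcard p {x. x + (- e) \<in> B} = rcard p B" by (rule rcard_translate[OF p0 perB])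
    moreover have "rcard p (A \<inter> {x. x + (- e) \<in> B}) = rcard p ?B"
    proof -
      have "rcard p {x. x + (- e) \<in> ?B} = rcard p ?B" by (rule rcard_translate[OF p0 perB'])
      moreover have "{x. x + (- e) \<in> ?B} = A \<inter> {x. x + (- e) \<in> B}" by auto
      ultimately show ?thesis by simp
    qed
    ultimately show ?thesis using IH rcard_mono[OF sub, of p] by linarith
  qed
qed

subsection \<open>Few translations leave a set almost invariant\<close>

primrec nfold :: "nat \<Rightarrow> int set \<Rightarrow> int set" where
  "nfold 0 Y = {0}"
| "nfold (Suc j) Y = sumset Y (nfold j Y)"

lemma sumsetI: "a \<in> A \<Longrightarrow> b \<in> B \<Longrightarrow> a + b \<in> sumset A B"
  unfolding sumset_def by blast

lemma sumsetE:
  assumes "x \<in> sumset A B"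
  obtains a b where "a \<in> A" "b \<in> B" "x = a + b"
  using assms unfolding sumset_def by blast

lemma nfold_lam_le:
  assumes p: "0 < p" and S: "periodic p S" and k: "\<And>y. y \<in> Y \<Longrightarrow> lam p S y \<le> k"
  shows "x \<in> nfold j Y \<Longrightarrow> lam p S x \<le> j * k"
proof (induction j arbitrary: x)
  case (Suc j)
  then obtain a b where "a \<in> Y" "b \<in> nfold j Y" "x = a + b"
    using sumsetE by (metis nfold.simps(2))
  then show ?case
    using Suc.IH[of b] k[of a] lam_add_le[OF p S, of a b] by simp
qed simp


text \<open>The interval from \<open>l\<close> to \<open>m\<close> contains the disjoint pieces from
  \<open>j * k\<close> to \<open>(j + 1) * k\<close> for all \<open>j < J\<close> with
  \<open>l \<le> j * k\<close> and, if \<open>l \<le> J * k\<close>, also the piece from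
  \<open>J * k\<close> to \<open>m\<close>.\<close>

lemma layer_cake:
  fixes m k l :: real
  assumes "0 \<le> k" "l \<le> m" "real J * k \<le> m"
  shows "k * real (card {j \<in> {..<J}. l \<le> real j * k}) + (if l \<le> real J * k then m - real J * k else 0) \<le> m - l"
  using assms(3)
proof (induction J)
  case 0
  then show ?case using assms by simp
next
  case (Suc J)
  have IH: "k * real (card {j \<in> {..<J}. l \<le> real j * k}) + (if l \<le> real J * k then m - real J * k else 0) \<le> m - l"
    using Suc assms(1) by (simp add: algebra_simps)
  show ?case
  proof (cases "l \<le> real J * k")
    case True
    have "{j \<in> {..<Suc J}. l \<le> real j * k} = insert J {j \<in> {..<J}. l \<le> real j * k}"
      using True by (auto simp: less_Suc_eq)
    then have "card {j \<in> {..<Suc J}. l \<le> real j * k} = Suc (card {j \<in> {..<J}. l \<le> real j * k})"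
      by simp
    moreover have "l \<le> real (Suc J) * k" using True assms(1) by (simp add: algebra_simps)
    ultimately show ?thesis using IH True by (simp add: algebra_simps)
  next
    case False
    have "l > real j * k" if "j < Suc J" for j
    proof -
      have "real j * k \<le> real J * k" using that assms(1) by (intro mult_right_mono) auto
      then show ?thesis using False by linarith
    qed
    then have "{j \<in> {..<Suc J}. l \<le> real j * k} = {}" by force
    then have "card {j \<in> {..<Suc J}. l \<le> real j * k} = 0" by (simp only: card.empty)
    then show ?thesis using assms Suc.prems by (simp only: mult_zero_right of_nat_0) auto
  qed
qed


lemma periodic_level:
  assumes "periodic p S"
  shows "periodic p {x. lam p S x \<le> k}"
proof (rule periodicI)
  fix x
  have "lam p S (x + p) = lam p S x"
    by (rule lam_cong[OF assms]) (simp add: cong_def)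
  then show "x + p \<in> {x. lam p S x \<le> k} \<longleftrightarrow> x \<in> {x. lam p S x \<le> k}" by simp
qed

text \<open>By subadditivity, level \<open>k\<close> plus level \<open>j * k\<close> lies in level
  \<open>Suc j * k\<close>; Cauchy--Davenport therefore adds \<open>2 * h\<close> residues per step,
  as long as the total stays within \<open>p\<close>.\<close>

lemma rcard_level:
  assumes p: "prime p" and S: "periodic p S"
    and h: "2 * h + 1 \<le> rcard p {x. lam p S x \<le> k}"
    and J: "2 * h * j + 1 \<le> nat p"
  shows "2 * h * j + 1 \<le> rcard p {x. lam p S x \<le> j * k}"
  using J
proof (induction j)
  case 0
  have "0 < rcard p {x. lam p S x \<le> 0 * k}"
    by (rule rcard_pos[OF prime_gt_0_int[OF p] periodic_level[OF S], of 0]) simp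
  then show ?case by simp
next
  case (Suc j)
  let ?Y = "{x. lam p S x \<le> k}" and ?X = "{x. lam p S x \<le> j * k}"
  have p0: "0 < p" using prime_gt_0_int[OF p] .
  have ne: "(0::int) \<in> ?Y" "(0::int) \<in> ?X" by simp_all
  have IH: "2 * h * j + 1 \<le> rcard p ?X" using Suc by simp
  have "min (nat p) (rcard p ?Y + rcard p ?X - 1) \<le> rcard p (sumset ?Y ?X)"
    using ne by (intro cauchy_davenport[OF p] periodic_level[OF S]) blast+
  moreover have "sumset ?Y ?X \<subseteq> {x. lam p S x \<le> Suc j * k}"
  proof
    fix x assume "x \<in> sumset ?Y ?X"
    then obtain a b where "lam p S a \<le> k" "lam p S b \<le> j * k" "x = a + b"
      by (elim sumsetE) simp
    then show "x \<in> {x. lam p S x \<le> Suc j * k}"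
      using lam_add_le[OF p0 S, of a b] by simp
  qed
  then have "rcard p (sumset ?Y ?X) \<le> rcard p {x. lam p S x \<le> Suc j * k}" by (rule rcard_mono)
  ultimately show ?case using IH h Suc.prems by simp
qed

lemma sum_lam:
  assumes p: "0 < p" and S: "periodic p S"
  shows "(\<Sum>x\<in>{0..<p}. real (rcard p S) - real (lam p S x)) = (real (rcard p S))\<^sup>2"
proof -
  have "real (rcard p S) - real (lam p S x) = real (rcard p {s \<in> S. s + x \<in> S})" for x
    using lam_eq[OF p S, of x] by linarith
  then show ?thesis using sum_rcard_overlap[OF p S] by (simp flip: of_nat_sum of_nat_power)
qed

lemma lam_le: "0 < p \<Longrightarrow> periodic p S \<Longrightarrow> lam p S x \<le> rcard p S"
  using lam_eq[of p S x] by linarith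

text \<open>The sum of \<open>rcard p S - lam p S x\<close> over all \<open>x\<close> is known
  exactly from \<open>sum_lam\<close>. The layer-cake bound, fed with the level sizes
  \<open>2 * h * j + 1\<close>, bounds the same sum from below.\<close>

lemma sum_level_inequality:
  assumes p: "prime p" and S: "periodic p S"
    and h: "2 * h + 1 \<le> rcard p {x. lam p S x \<le> k}"
    and J: "2 * h * J + 1 \<le> nat p" and Jk: "J * k \<le> rcard p S"
  shows "real (rcard p S) * (2 * real h * real J + 1) - real k * real h * real J * (real J + 1) \<le> (real (rcard p S))\<^sup>2"
proof -
  let ?m = "real (rcard p S)" and ?I = "{0..<p}" and ?l = "\<lambda>x. lam p S x"
  have p0: "0 < p" using prime_gt_0_int[OF p] .
  have Jk': "real J * real k \<le> ?m" using Jk by (metis of_nat_le_iff of_nat_mult)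
  have level: "2 * real h * real j + 1 \<le> real (rcard p {x. ?l x \<le> j * k})" if "j \<le> J" for j
  proof -
    have "2 * h * j + 1 \<le> nat p" using J that by (meson add_le_mono1 le_trans mult_le_mono2)
    then have "2 * h * j + 1 \<le> rcard p {x. ?l x \<le> j * k}" by (rule rcard_level[OF p S h])
    then have "real (2 * h * j + 1) \<le> real (rcard p {x. ?l x \<le> j * k})" by (rule of_nat_mono)
    then show ?thesis by simp
  qed
  have swap: "(\<Sum>x\<in>?I. real (card {j \<in> {..<J}. ?l x \<le> j * k})) = (\<Sum>j<J. real (rcard p {x. ?l x \<le> j * k}))"
  proof -
    have "(\<Sum>x\<in>?I. real (card {j \<in> {..<J}. ?l x \<le> j * k})) = (\<Sum>x\<in>?I. \<Sum>j<J. if ?l x \<le> j * k then 1 else 0)"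
      by (intro sum.cong refl) (simp add: sum.If_cases Int_def)
    also have "\<dots> = (\<Sum>j<J. \<Sum>x\<in>?I. if ?l x \<le> j * k then 1 else 0)" by (rule sum.swap)
    also have "\<dots> = (\<Sum>j<J. real (rcard p {x. ?l x \<le> j * k}))"
    proof (intro sum.cong refl)
      fix j
      have "{x. ?l x \<le> j * k} \<inter> ?I = ?I \<inter> {x. ?l x \<le> j * k}" by (rule Int_commute)
      then show "(\<Sum>x\<in>?I. if ?l x \<le> j * k then 1 else 0) = real (rcard p {x. ?l x \<le> j * k})"
        by (simp add: sum.If_cases rcard_def)
    qed
    finally show ?thesis .
  qed
  have top: "(\<Sum>x\<in>?I. if ?l x \<le> J * k then ?m - real J * k else 0) = (?m - real J * k) * real (rcard p {x. ?l x \<le> J * k})"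
  proof -
    have "{x. ?l x \<le> J * k} \<inter> ?I = ?I \<inter> {x. ?l x \<le> J * k}" by (rule Int_commute)
    then show ?thesis by (simp add: sum.If_cases rcard_def)
  qed
  have gauss: "(\<Sum>j<n. 2 * real h * real j + 1) = real h * real n * (real n - 1) + real n" for n
    by (induction n) (auto simp: algebra_simps)
  have "real k * (real h * real J * (real J - 1) + real J) + (?m - real J * k) * (2 * real h * real J + 1)
      \<le> real k * (\<Sum>j<J. real (rcard p {x. ?l x \<le> j * k})) + (?m - real J * k) * real (rcard p {x. ?l x \<le> J * k})"
  proof (rule add_mono)
    show "real k * (real h * real J * (real J - 1) + real J) \<le> real k * (\<Sum>j<J. real (rcard p {x. ?l x \<le> j * k}))"
      unfolding gauss[symmetric] by (intro mult_left_mono sum_mono level) auto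
    show "(?m - real J * k) * (2 * real h * real J + 1) \<le> (?m - real J * k) * real (rcard p {x. ?l x \<le> J * k})"
      using Jk' by (intro mult_left_mono level) auto
  qed
  also have "\<dots> = (\<Sum>x\<in>?I. real k * real (card {j \<in> {..<J}. ?l x \<le> j * k}) + (if ?l x \<le> J * k then ?m - real J * k else 0))"
    unfolding sum.distrib top swap[symmetric] by (simp add: sum_distrib_left)
  also have "\<dots> \<le> (\<Sum>x\<in>?I. ?m - real (?l x))"
  proof (rule sum_mono)
    fix x
    show "real k * real (card {j \<in> {..<J}. ?l x \<le> j * k}) + (if ?l x \<le> J * k then ?m - real J * k else 0) \<le> ?m - real (?l x)"
      using layer_cake[of "real k" "real (?l x)" ?m J] Jk' lam_le[OF p0 S, of x]
      by (simp flip: of_nat_mult)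
  qed
  also have "\<dots> = ?m\<^sup>2" by (rule sum_lam[OF p0 S])
  finally show ?thesis by (simp add: algebra_simps)
qed

text \<open>Write the size of \<open>S\<close> as \<open>h * J + r\<close> with
  \<open>r < h\<close>. The level inequality then gives
  \<open>h^2 * (J^2 - 1) \<le> k * h * J * (J + 1)\<close>, and cancelling
  \<open>h * (J + 1)\<close> leaves the claim. That \<open>S\<close> fills less than half of the
  residues is what admits levels up to \<open>J\<close>.\<close>

lemma lam_growth_aux:
  assumes p: "prime p" and S: "periodic p S"
    and m: "2 * rcard p S < nat p" and h: "1 \<le> h" "h \<le> rcard p S"
    and Y: "2 * h + 1 \<le> rcard p {x. lam p S x \<le> k}"
  shows "h * (rcard p S div h - 1) \<le> k * (rcard p S div h)"
proof (cases "h \<le> k")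
  case True
  then show ?thesis by (intro mult_mono) auto
next
  case False
  define m where "m = rcard p S"
  define J where "J = m div h"
  define r where "r = m mod h"
  have J1: "1 \<le> J" using h by (simp add: J_def m_def div_greater_zero_iff Suc_le_eq)
  have mr: "m = h * J + r" by (simp add: J_def r_def)
  have r: "r < h" using h by (simp add: r_def)
  have "J * k \<le> h * J" using False by simp
  then have Jk: "J * k \<le> rcard p S" using mr unfolding m_def[symmetric] by linarith
  have Jp: "2 * h * J + 1 \<le> nat p" using m mr by (simp add: m_def[symmetric])
  have "real m * (2 * real h * real J + 1) - real k * real h * real J * (real J + 1) \<le> (real m)\<^sup>2"
    using sum_level_inequality[OF p S Y Jp Jk] by (simp add: m_def)
  moreover have "real m = real h * real J + real r" by (simp add: mr)
  ultimately have "(real h * real J)\<^sup>2 - (real r)\<^sup>2 + real h * real J + real r \<le> real k * real h * real J * (real J + 1)"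
    by (simp add: algebra_simps power2_eq_square)
  moreover have "(real r)\<^sup>2 \<le> (real h)\<^sup>2" using r by (intro power_mono) auto
  ultimately have "(real h * real J)\<^sup>2 - (real h)\<^sup>2 \<le> real k * real h * real J * (real J + 1)"
    by (smt (verit) mult_nonneg_nonneg of_nat_0_le_iff)
  then have "real h * (real J + 1) * (real h * (real J - 1)) \<le> real h * (real J + 1) * (real k * real J)"
    by (simp add: algebra_simps power2_eq_square)
  then have "real h * (real J - 1) \<le> real k * real J"
    using h by (subst (asm) mult_le_cancel_left_pos) auto
  then have "real (h * (J - 1)) \<le> real (k * J)" using J1 by (simp add: of_nat_diff)
  then have "h * (J - 1) \<le> k * J" by (subst (asm) of_nat_le_iff)
  then show ?thesis by (simp add: J_def m_def)
qed

text \<open>\<open>S\<close> and its complement have the same \<open>lam\<close>, and as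
  \<open>p\<close> is odd one of them has fewer than \<open>p / 2\<close> residues. The conclusion
  is \<open>k \<ge> h * (1 - 1 / J)\<close>: about \<open>2 * h\<close> residues of value at most
  \<open>k\<close> force \<open>k\<close> to be nearly \<open>h\<close>.\<close>

lemma lam_growth:
  assumes p: "prime p" "2 < p" and S: "periodic p S"
    and h: "1 \<le> h" and J: "1 \<le> J" "J * h \<le> rcard p S" "J * h \<le> rcard p (- S)"
    and Y: "2 * h + 1 \<le> rcard p {x. lam p S x \<le> k}"
  shows "h * (J - 1) \<le> k * J"
proof (cases "h \<le> k")
  case True
  then show ?thesis by (intro mult_mono) auto
next
  case False
  have p0: "0 < p" using p by simp
  have odd: "odd (nat p)" using p prime_odd_int[of p] by (simp add: even_nat_iff)
  have total: "rcard p S + rcard p (- S) = nat p" by (rule rcard_Compl[OF p0])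
  have main: "h * (J - 1) \<le> k * J"
    if T: "periodic p T" and m: "2 * rcard p T < nat p" and JT: "J * h \<le> rcard p T"
      and YT: "2 * h + 1 \<le> rcard p {x. lam p T x \<le> k}" for T
  proof -
    define J' where "J' = rcard p T div h"
    have "1 * h \<le> J * h" using J by (intro mult_right_mono) auto
    then have hT: "h \<le> rcard p T" using JT by linarith
    have "J \<le> J'" unfolding J'_def using JT h by (simp add: less_eq_div_iff_mult_less_eq)
    have "h * (J' - 1) \<le> k * J'"
      unfolding J'_def by (rule lam_growth_aux[OF p(1) T m h hT YT])
    \<comment> \<open>In this form the inequality passes from \<open>J'\<close> down to any smaller
      \<open>J\<close>.\<close>
    then have "(h - k) * J' \<le> h" by (simp add: diff_mult_distrib diff_mult_distrib2)
    moreover have "(h - k) * J \<le> (h - k) * J'" using \<open>J \<le> J'\<close> by simp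
    ultimately have "(h - k) * J \<le> h" by linarith
    then show ?thesis by (simp add: diff_mult_distrib diff_mult_distrib2)
  qed
  have "2 * rcard p S \<noteq> nat p" using odd by (metis dvd_triv_left)
  then consider "2 * rcard p S < nat p" | "2 * rcard p (- S) < nat p" using total by linarith
  then show ?thesis
  proof cases
    case 1
    show ?thesis by (rule main[OF S 1 J(2) Y])
  next
    case 2
    show ?thesis by (rule main[OF periodic_Compl[OF S] 2 J(3)]) (use Y in \<open>simp add: lam_Compl[OF p0 S]\<close>)
  qed
qed

subsection \<open>A frequency correlated with all almost-periods\<close>

text \<open>Real part of a geometric series in a \<open>p\<close>-th root of unity, which equals 1
  exactly when \<open>p\<close> divides \<open>z\<close>.\<close>

lemma sum_cos_orthogonal:
  assumes p: "0 < (p::int)"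
  shows "(\<Sum>r\<in>{0..<p}. cos (2 * pi * of_int r * of_int z / of_int p)) = (if p dvd z then of_int p else 0)"
proof -
  define w where "w = cis (2 * pi * of_int z / of_int p)"
  have "(\<Sum>r\<in>{0..<p}. cos (2 * pi * of_int r * of_int z / of_int p))
      = (\<Sum>n<nat p. cos (2 * pi * of_int (int n) * of_int z / of_int p))"
    by (rule sum.reindex_bij_witness[of _ int nat]) (use p in auto)
  also have "\<dots> = (\<Sum>n<nat p. Re (w ^ n))"
    by (intro sum.cong refl) (simp add: w_def DeMoivre mult_ac)
  also have "\<dots> = Re (\<Sum>n<nat p. w ^ n)" by simp
  also have "\<dots> = (if p dvd z then of_int p else 0)"
  proof (cases "p dvd z")
    case True
    then obtain k where k: "z = p * k" by (elim dvdE)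
    have eq: "2 * pi * of_int z / of_int p = 2 * pi * of_int k" using p by (simp add: k)
    have "w = 1"
      unfolding w_def eq by (rule complex_eqI) (simp_all only: cis.sel cos_int_2pin sin_int_2pin one_complex.sel)
    then show ?thesis using True p by simp
  next
    case False
    have "w \<noteq> 1"
    proof
      assume "w = 1"
      then have "cos (2 * pi * of_int z / of_int p) = 1" by (simp add: w_def complex_eq_iff)
      then obtain n :: int where "2 * pi * of_int z / of_int p = of_int n * 2 * pi"
        unfolding cos_one_2pi_int by auto
      then have "real_of_int z = of_int (p * n)" using p by (simp add: field_simps)
      then have "z = p * n" by (subst (asm) of_int_eq_iff)
      then show False using False by simp
    qed
    moreover have "w ^ nat p = 1"
    proof -
      have "w ^ nat p = cis (2 * pi * of_int z)" using p by (simp add: w_def DeMoivre)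
      then show ?thesis using cos_int_2pin[of z] sin_int_2pin[of z] by (simp add: complex_eq_iff)
    qed
    ultimately have "(\<Sum>n<nat p. w ^ n) = 0" by (simp add: geometric_sum)
    then show ?thesis using False by simp
  qed
  finally show ?thesis .
qed

text \<open>For each \<open>s\<close> exactly one \<open>t\<close> in \<open>{0..<p}\<close> is
  congruent to \<open>s + x\<close>, so the double sum counts the \<open>s\<close> that
  \<open>x\<close> keeps inside \<open>S\<close>.\<close>

lemma count_shift:
  assumes p: "0 < p" and S: "periodic p S"
  shows "(\<Sum>s\<in>S \<inter> {0..<p}. \<Sum>t\<in>S \<inter> {0..<p}. if p dvd s - t + x then 1 else 0) = real (rcard p S) - real (lam p S x)"
proof -
  let ?I = "{0..<p}"
  have "(\<Sum>t\<in>S \<inter> ?I. if p dvd s - t + x then 1 else 0) = (if s + x \<in> S then 1 else (0::real))" for s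
  proof -
    have eq: "p dvd s - t + x \<longleftrightarrow> t = (s + x) mod p" if "t \<in> ?I" for t
    proof -
      have "p dvd s - t + x \<longleftrightarrow> p dvd (s + x) - t" by (simp add: algebra_simps)
      also have "\<dots> \<longleftrightarrow> (s + x) mod p = t mod p" by (simp only: mod_eq_dvd_iff)
      also have "t mod p = t" using that by simp
      finally show ?thesis by auto
    qed
    have "(\<Sum>t\<in>S \<inter> ?I. if p dvd s - t + x then 1 else 0) = (\<Sum>t\<in>S \<inter> ?I. if t = (s + x) mod p then 1 else (0::real))"
      by (intro sum.cong refl) (simp add: eq)
    also have "\<dots> = (if (s + x) mod p \<in> S \<inter> ?I then 1 else 0)" by simp
    also have "(s + x) mod p \<in> S \<inter> ?I \<longleftrightarrow> s + x \<in> S" using p periodic_mod[OF S] by simp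
    finally show ?thesis .
  qed
  then have "(\<Sum>s\<in>S \<inter> ?I. \<Sum>t\<in>S \<inter> ?I. if p dvd s - t + x then 1 else 0) = (\<Sum>s\<in>S \<inter> ?I. if s + x \<in> S then 1 else (0::real))"
    by simp
  also have "\<dots> = real (rcard p {s \<in> S. s + x \<in> S})"
  proof -
    have "{s \<in> S. s + x \<in> S} \<inter> ?I = S \<inter> ?I \<inter> {s. s + x \<in> S}" by auto
    then show ?thesis by (simp add: sum.If_cases rcard_def)
  qed
  also have "\<dots> = real (rcard p S) - real (lam p S x)" using lam_eq[OF p S, of x] by linarith
  finally show ?thesis .
qed

text \<open>Squared modulus of the Fourier coefficient of the indicator function of \<open>S\<close>
  at frequency \<open>r\<close>, in real form.\<close>

definition spectrum :: "int \<Rightarrow> int set \<Rightarrow> int \<Rightarrow> real" where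
  "spectrum p S r = (\<Sum>s\<in>S \<inter> {0..<p}. cos (2 * pi * of_int r * of_int s / of_int p))\<^sup>2
    + (\<Sum>s\<in>S \<inter> {0..<p}. sin (2 * pi * of_int r * of_int s / of_int p))\<^sup>2"

text \<open>The transform of the power spectrum is the autocorrelation. Expanding the squares gives
  cosines at the differences \<open>s - t\<close>; the factor \<open>cos\<close> splits them into
  the shifts by \<open>x\<close> and \<open>- x\<close>, whose overlap counts agree.\<close>

lemma sum_spectrum_cos:
  assumes p: "0 < p" and S: "periodic p S"
  shows "(\<Sum>r\<in>{0..<p}. spectrum p S r * cos (2 * pi * of_int r * of_int x / of_int p))
    = of_int p * (real (rcard p S) - real (lam p S x))"
proof -
  let ?I = "{0..<p}" and ?c = "\<lambda>r z. cos (2 * pi * of_int r * of_int z / of_int p)"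
  have prod: "?c r a * ?c r b = (?c r (a + b) + ?c r (a + - b)) / 2" for r a b
    by (simp add: cos_times_cos algebra_simps diff_divide_distrib add_divide_distrib)
  have "spectrum p S r * ?c r x = (\<Sum>s\<in>S \<inter> ?I. \<Sum>t\<in>S \<inter> ?I. (?c r (s - t + x) + ?c r (s - t + - x)) / 2)" for r
  proof -
    have "spectrum p S r = (\<Sum>s\<in>S \<inter> ?I. \<Sum>t\<in>S \<inter> ?I. ?c r (s - t))"
      unfolding spectrum_def power2_eq_square sum_product sum.distrib[symmetric]
      by (intro sum.cong refl) (simp add: cos_diff[symmetric] algebra_simps diff_divide_distrib)
    then have "spectrum p S r * ?c r x = (\<Sum>s\<in>S \<inter> ?I. \<Sum>t\<in>S \<inter> ?I. ?c r (s - t) * ?c r x)"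
      by (simp add: sum_distrib_right)
    also have "\<dots> = (\<Sum>s\<in>S \<inter> ?I. \<Sum>t\<in>S \<inter> ?I. (?c r (s - t + x) + ?c r (s - t + - x)) / 2)"
      by (simp only: prod)
    finally show ?thesis .
  qed
  then have "(\<Sum>r\<in>?I. spectrum p S r * ?c r x) = (\<Sum>r\<in>?I. \<Sum>s\<in>S \<inter> ?I. \<Sum>t\<in>S \<inter> ?I. (?c r (s - t + x) + ?c r (s - t + - x)) / 2)"
    by simp
  also have "\<dots> = (\<Sum>s\<in>S \<inter> ?I. \<Sum>r\<in>?I. \<Sum>t\<in>S \<inter> ?I. (?c r (s - t + x) + ?c r (s - t + - x)) / 2)"
    by (rule sum.swap)
  also have "\<dots> = (\<Sum>s\<in>S \<inter> ?I. \<Sum>t\<in>S \<inter> ?I. \<Sum>r\<in>?I. (?c r (s - t + x) + ?c r (s - t + - x)) / 2)"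
    by (intro sum.cong refl sum.swap)
  also have "\<dots> = (\<Sum>s\<in>S \<inter> ?I. \<Sum>t\<in>S \<inter> ?I. of_int p / 2 * ((if p dvd s - t + x then 1 else 0) + (if p dvd s - t + - x then 1 else 0)))"
  proof (intro sum.cong refl)
    fix s t
    show "(\<Sum>r\<in>?I. (?c r (s - t + x) + ?c r (s - t + - x)) / 2)
      = of_int p / 2 * ((if p dvd s - t + x then 1 else 0) + (if p dvd s - t + - x then 1 else 0))"
      unfolding sum_divide_distrib[symmetric] sum.distrib sum_cos_orthogonal[OF p] by simp
  qed
  also have "\<dots> = of_int p / 2 * ((real (rcard p S) - real (lam p S x)) + (real (rcard p S) - real (lam p S (- x))))"
    unfolding count_shift[OF p S, symmetric] sum.distrib[symmetric] sum_distrib_left ..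
  also have "\<dots> = of_int p * (real (rcard p S) - real (lam p S x))"
    unfolding lam_uminus[OF p S] by (simp only: mult_2[symmetric])
  finally show ?thesis .
qed

text \<open>Averaging with the spectrum as weight. By Parseval the nonzero frequencies have total
  weight \<open>m * (p - m)\<close>, where \<open>m\<close> is the size of \<open>S\<close>. The
  weighted sum of the \<open>1 - cos\<close> terms is \<open>p\<close> times the sum of
  \<open>lam\<close> over \<open>R\<close>, with nothing from frequency 0. Some nonzero frequency is
  at most the average.\<close>

lemma exists_frequency:
  assumes p: "0 < p" and S: "periodic p S" and m: "0 < rcard p S" "rcard p S < nat p"
    and R: "finite R" "\<And>x. x \<in> R \<Longrightarrow> lam p S x \<le> k"
  shows "\<exists>r\<in>{1..<p}. real (rcard p S) * (of_int p - real (rcard p S))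
      * (\<Sum>x\<in>R. 1 - cos (2 * pi * of_int r * of_int x / of_int p)) \<le> of_int p * real (card R) * real k"
proof (rule ccontr)
  let ?m = "real (rcard p S)" and ?f = "spectrum p S"
    and ?G = "\<lambda>r. \<Sum>x\<in>R. 1 - cos (2 * pi * of_int r * of_int x / of_int p)"
    and ?K = "of_int p * real (card R) * real k"
  assume "\<not> ?thesis"
  then have big: "?m * (of_int p - ?m) * ?G r > ?K" if "r \<in> {1..<p}" for r
    using that by (meson not_le)
  have I: "{0..<p} = insert 0 {1..<p}" using p by auto
  have f_nonneg: "0 \<le> ?f r" for r by (simp add: spectrum_def)
  have f0: "?f 0 = ?m\<^sup>2" by (simp add: spectrum_def rcard_def)
  have "(\<Sum>r\<in>{0..<p}. ?f r) = of_int p * ?m"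
    using sum_spectrum_cos[OF p S, of 0] by simp
  then have mass: "(\<Sum>r\<in>{1..<p}. ?f r) = ?m * (of_int p - ?m)"
    unfolding I using f0 by (simp add: algebra_simps power2_eq_square)
  have "?f r * ?G r = (\<Sum>x\<in>R. ?f r - ?f r * cos (2 * pi * of_int r * of_int x / of_int p))" for r
    by (simp add: sum_distrib_left right_diff_distrib)
  then have "(\<Sum>r\<in>{0..<p}. ?f r * ?G r)
      = (\<Sum>x\<in>R. \<Sum>r\<in>{0..<p}. ?f r - ?f r * cos (2 * pi * of_int r * of_int x / of_int p))"
    by (simp only:) (rule sum.swap)
  also have "\<dots> = (\<Sum>x\<in>R. of_int p * real (lam p S x))"
    unfolding sum_subtractf[of _ _ "{0..<p}"] sum_spectrum_cos[OF p S] \<open>(\<Sum>r\<in>{0..<p}. ?f r) = of_int p * ?m\<close>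
    by (intro sum.cong refl) (simp add: algebra_simps)
  also have "\<dots> \<le> (\<Sum>x\<in>R. of_int p * real k)"
    using R p by (intro sum_mono mult_left_mono) auto
  finally have total: "(\<Sum>r\<in>{1..<p}. ?f r * ?G r) \<le> ?K"
    unfolding I by (simp add: mult_ac)
  have mp: "0 < ?m * (of_int p - ?m)"
    using m by (intro mult_pos_pos) (auto simp: zless_nat_eq_int_zless)
  \<comment> \<open>If all nonzero frequencies exceeded the average, this sum of nonnegative terms
    would be at most 0; every weight would vanish, contradicting the positive total weight.\<close>
  have "(\<Sum>r\<in>{1..<p}. ?f r * (?m * (of_int p - ?m) * ?G r - ?K))
      = ?m * (of_int p - ?m) * (\<Sum>r\<in>{1..<p}. ?f r * ?G r) - ?K * (\<Sum>r\<in>{1..<p}. ?f r)"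
    by (simp add: right_diff_distrib sum_subtractf sum_distrib_left mult_ac)
  also have "\<dots> \<le> 0"
    unfolding mass using mult_left_mono[OF total less_imp_le[OF mp]] by (simp add: mult_ac)
  finally have le: "(\<Sum>r\<in>{1..<p}. ?f r * (?m * (of_int p - ?m) * ?G r - ?K)) \<le> 0" .
  have nonneg: "0 \<le> ?f r * (?m * (of_int p - ?m) * ?G r - ?K)" if "r \<in> {1..<p}" for r
    using big[OF that] f_nonneg[of r] by (intro mult_nonneg_nonneg) auto
  have "(\<Sum>r\<in>{1..<p}. ?f r * (?m * (of_int p - ?m) * ?G r - ?K)) = 0"
    by (rule antisym[OF le sum_nonneg[OF nonneg]])
  then have "\<forall>r\<in>{1..<p}. ?f r * (?m * (of_int p - ?m) * ?G r - ?K) = 0"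
    by (subst (asm) sum_nonneg_eq_0_iff[OF finite_atLeastLessThan_int nonneg])
  then have zero: "?f r * (?m * (of_int p - ?m) * ?G r - ?K) = 0" if "r \<in> {1..<p}" for r
    using that by (rule bspec)
  have "?f r = 0" if "r \<in> {1..<p}" for r
    using zero[OF that] big[OF that] by (simp only: mult_eq_0_iff) linarith
  then have "(\<Sum>r\<in>{1..<p}. ?f r) = 0" by simp
  then show False using mass mp by linarith
qed

subsection \<open>Subset sums of dense sets of integers\<close>

text \<open>The empty sum is included, in contrast to \<open>subset_sums\<close>, so that adjoining
  \<open>x\<close> yields exactly the old sums and their translate. The difference is bridged by
  \<open>incomplete_remove\<close>.\<close>

definition ssums :: "int set \<Rightarrow> int set" where
  "ssums B = (\<lambda>C. \<Sum>C) ` Pow B"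

lemma ssums_mono: "A \<subseteq> B \<Longrightarrow> ssums A \<subseteq> ssums B"
  unfolding ssums_def by (intro image_mono Pow_mono)

lemma ssums_insert:
  assumes "finite B" "x \<notin> B"
  shows "ssums (insert x B) = ssums B \<union> (\<lambda>s. s + x) ` ssums B"
proof -
  have "\<Sum>(insert x C) = \<Sum>C + x" if "C \<subseteq> B" for C
    using that assms finite_subset[of C B] by (subst sum.insert) (auto simp: add.commute)
  then have "(\<lambda>C. \<Sum>C) ` insert x ` Pow B = (\<lambda>s. s + x) ` ssums B"
    unfolding ssums_def image_image by (intro image_cong refl) simp
  then show ?thesis
    unfolding ssums_def Pow_insert image_Un by simp
qed

lemma ssums_add:
  assumes "finite B" "x \<notin> B" "s \<in> ssums B"
  shows "s \<in> ssums (insert x B)" "s + x \<in> ssums (insert x B)"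
  using assms(3) by (auto simp: ssums_insert[OF assms(1,2)])

lemma ssums_complement:
  assumes "finite B" "s \<in> ssums B"
  shows "\<Sum>B - s \<in> ssums B"
proof -
  obtain C where C: "C \<subseteq> B" "s = \<Sum>C" using assms(2) by (auto simp: ssums_def)
  then have "\<Sum>B - s = \<Sum>(B - C)" using assms(1) by (simp add: sum_diff)
  then show ?thesis unfolding ssums_def by blast
qed

lemma ssums_uminus:
  assumes "finite B" "s \<in> ssums (uminus ` B)"
  shows "- s \<in> ssums B"
proof -
  obtain C where C: "C \<subseteq> uminus ` B" "s = \<Sum>C" using assms(2) by (auto simp: ssums_def)
  have "- s = \<Sum>(uminus ` C)"
    unfolding C(2) by (subst sum.reindex) (auto simp: sum_negf inj_on_def)
  moreover have "uminus ` C \<subseteq> B" using C(1) by force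
  ultimately show ?thesis unfolding ssums_def by blast
qed

text \<open>Adjoining \<open>x\<close> unites the interval with its translate by \<open>x\<close>,
  and no gap arises while \<open>\<bar>x\<bar>\<close> is at most the number of integers in it.
  Positive elements push the upper end, negative ones the lower end.\<close>

lemma ssums_interval_extend:
  assumes "finite B" "finite E" "B \<inter> E = {}" "{l..u} \<subseteq> ssums B" "\<And>x. x \<in> E \<Longrightarrow> \<bar>x\<bar> \<le> u - l + 1"
  shows "{l + (\<Sum>x\<in>E. min x 0)..u + (\<Sum>x\<in>E. max x 0)} \<subseteq> ssums (B \<union> E)"
  using assms(2,3,5)
proof (induction E rule: finite_induct)
  case empty
  then show ?case using assms(4) by simp
next
  case (insert x E)
  define l' where "l' = l + (\<Sum>x\<in>E. min x 0)"
  define u' where "u' = u + (\<Sum>x\<in>E. max x 0)"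
  have IH: "{l'..u'} \<subseteq> ssums (B \<union> E)" unfolding l'_def u'_def using insert by simp
  have "(\<Sum>x\<in>E. min x 0) \<le> 0" by (rule sum_nonpos) simp
  moreover have "0 \<le> (\<Sum>x\<in>E. max x 0)" by (rule sum_nonneg) simp
  ultimately have x: "\<bar>x\<bar> \<le> u' - l' + 1"
    using insert.prems(2)[of x] unfolding l'_def u'_def by simp
  have fin: "finite (B \<union> E)" "x \<notin> B \<union> E" using insert assms(1) by auto
  have "{l' + min x 0..u' + max x 0} \<subseteq> ssums (insert x (B \<union> E))"
  proof
    fix s assume s: "s \<in> {l' + min x 0..u' + max x 0}"
    show "s \<in> ssums (insert x (B \<union> E))"
    proof (cases "s \<in> {l'..u'}")
      case True
      then show ?thesis using IH ssums_add(1)[OF fin] by blast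
    next
      case False
      then have "s - x \<in> {l'..u'}" using s x by auto
      then show ?thesis using IH ssums_add(2)[OF fin, of "s - x"] by auto
    qed
  qed
  then show ?case using insert(1,2) unfolding l'_def u'_def by (simp add: ac_simps)
qed

text \<open>\<open>V\<close> and its reflection \<open>r - V\<close> lie in a common interval of at
  most \<open>M + s\<close> integers, so they share two elements. Two are required because one of
  them may be the useless \<open>r / 2\<close>.\<close>

lemma exists_pair_sum:
  fixes M :: int
  assumes M: "0 \<le> M" and V: "V \<subseteq> {1..M}" and c: "M + s + 2 \<le> 2 * int (card V)" and r: "\<bar>r - (M + 1)\<bar> \<le> s"
  shows "\<exists>v\<in>V. \<exists>w\<in>V. v \<noteq> w \<and> v + w = r"
proof -
  let ?W = "(\<lambda>v. r - v) ` V"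
  have fin: "finite V" by (rule finite_subset[OF V]) simp
  have cW: "card ?W = card V" by (rule card_image) (simp add: inj_on_def)
  have sub: "V \<union> ?W \<subseteq> {min 1 (r - M)..max M (r - 1)}"
  proof
    fix x assume "x \<in> V \<union> ?W"
    then consider "x \<in> V" | v where "v \<in> V" "x = r - v" by blast
    then show "x \<in> {min 1 (r - M)..max M (r - 1)}"
    proof cases
      case 1
      then have "1 \<le> x" "x \<le> M" using V by auto
      then show ?thesis by (auto simp: min_def max_def)
    next
      case 2
      then have "1 \<le> v" "v \<le> M" using V by auto
      then show ?thesis using 2(2) by (auto simp: min_def max_def)
    qed
  qed
  have "card (V \<union> ?W) \<le> card {min 1 (r - M)..max M (r - 1)}" by (rule card_mono[OF _ sub]) simp
  then have "int (card (V \<union> ?W)) \<le> int (card {min 1 (r - M)..max M (r - 1)})"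
    by (simp only: of_nat_le_iff)
  also have "\<dots> \<le> M + s" using r M by auto
  finally have "int (card (V \<inter> ?W)) \<ge> 2"
    using card_Un_Int[of V ?W] fin cW c by simp
  then have "\<not> card (V \<inter> ?W) \<le> Suc 0" by simp
  then obtain v w where vw: "v \<in> V \<inter> ?W" "w \<in> V \<inter> ?W" "v \<noteq> w"
    using fin by (subst (asm) card_le_Suc0_iff_eq) auto
  then consider "2 * v \<noteq> r" | "2 * w \<noteq> r" by linarith
  then show ?thesis
  proof cases
    case 1
    then have "v \<in> V" "r - v \<in> V" "v \<noteq> r - v" "v + (r - v) = r" using vw by auto
    then show ?thesis by blast
  next
    case 2
    then have "w \<in> V" "r - w \<in> V" "w \<noteq> r - w" "w + (r - w) = r" using vw by auto
    then show ?thesis by blast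
  qed
qed

text \<open>Pairs are split off one at a time; each costs two elements, that is 4 in
  \<open>2 * int (card V)\<close>, whence the term \<open>4 * int l\<close>.\<close>

lemma pair_sums_cover:
  fixes M :: int
  assumes M: "0 \<le> M" and "V \<subseteq> {1..M}" "M + s + 2 + 4 * int l \<le> 2 * int (card V)" "0 \<le> s"
    "r \<in> {int l * (M + 1 - s)..int l * (M + 1 + s)}"
  shows "r \<in> ssums V"
  using assms(2,3,5)
proof (induction l arbitrary: V r)
  case 0
  then have "r = \<Sum>{}" by simp
  then show ?case unfolding ssums_def by blast
next
  case (Suc l)
  define a where "a = M + 1 - s"
  define b where "b = M + 1 + s"
  have lr: "int l * a + a \<le> r" "r \<le> int l * b + b"
    using Suc.prems(3) by (auto simp: a_def b_def algebra_simps)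
  have ab: "a \<le> b" "int l * a \<le> int l * b" using assms(4) by (auto simp: a_def b_def intro: mult_left_mono)
  \<comment> \<open>The least admissible pair sum that leaves a remainder of at most
    \<open>int l * b\<close>, within reach of the other \<open>l\<close> pairs.\<close>
  define t where "t = max a (r - int l * b)"
  have t: "a \<le> t" "t \<le> b" "r - t \<in> {int l * a..int l * b}"
    using lr ab by (auto simp: t_def)
  have fin: "finite V" by (rule finite_subset[OF Suc.prems(1)]) simp
  have "\<bar>t - (M + 1)\<bar> \<le> s" using t(1,2) by (auto simp: a_def b_def)
  moreover have "M + s + 2 \<le> 2 * int (card V)" using Suc.prems(2) by simp
  ultimately obtain v w where vw: "v \<in> V" "w \<in> V" "v \<noteq> w" "v + w = t"
    using exists_pair_sum[OF M Suc.prems(1)] by blast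
  define U where "U = V - {v, w}"
  have "card {v, w} \<le> card V" using vw fin by (intro card_mono) auto
  then have "int (card U) = int (card V) - 2" unfolding U_def using vw fin by (simp add: card_Diff_subset)
  then have "r - t \<in> ssums U"
    using Suc.prems(1,2) t(3) by (intro Suc.IH) (auto simp: U_def a_def b_def)
  moreover have U: "finite U" "v \<notin> U" "w \<notin> insert v U" using fin vw by (auto simp: U_def)
  ultimately have "r - t + v \<in> ssums (insert v U)" by (intro ssums_add(2))
  then have "r - t + v + w \<in> ssums (insert w (insert v U))"
    using U(1,3) ssums_add(2) by (metis finite.insertI)
  moreover have "insert w (insert v U) = V" using vw by (auto simp: U_def)
  moreover have "r - t + v + w = r" using vw(4) by simp
  ultimately show ?case by (simp only:)
qed

text \<open>Six pairs reach \<open>6 * (M + 1)\<close> up to an error \<open>6 * s\<close>, and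
  seven pairs reach \<open>7 * (M + 1)\<close> up to \<open>7 * s\<close>. The two ranges leave no
  gap precisely when \<open>M \<le> 13 * s\<close>, and \<open>30 = 2 + 4 * 7\<close> pays for seven
  pairs. The resulting \<open>M + 2\<close> consecutive integers suffice for extension by elements
  of size at most \<open>M\<close>.\<close>

lemma dense_interval:
  fixes M :: int
  assumes M: "0 \<le> M" and V: "V \<subseteq> {1..M}" and c: "M + s + 30 \<le> 2 * int (card V)" and s: "0 \<le> s" "M \<le> 13 * s"
  shows "{6 * M + 6..7 * M + 7} \<subseteq> ssums V"
proof
  fix r assume r: "r \<in> {6 * M + 6..7 * M + 7}"
  show "r \<in> ssums V"
  proof (cases "r \<le> 6 * (M + 1 + s)")
    case True
    then show ?thesis using r c s by (intro pair_sums_cover[OF M V, of s 6]) auto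
  next
    case False
    then show ?thesis using r c s by (intro pair_sums_cover[OF M V, of s 7]) auto
  qed
qed

text \<open>The negative elements alone produce a starting interval, which the positive ones extend
  to the upper end. The lower end follows by the reflection \<open>x \<mapsto> \<Sum>Q - x\<close>
  of the subset sums; \<open>0 \<le> \<Sum>Q\<close> makes the interval and its mirror image
  overlap.\<close>

lemma two_sided_interval_aux:
  fixes M :: int
  assumes M: "0 \<le> M" and Q: "Q \<subseteq> {-M..M}" "0 \<notin> Q" and s: "0 \<le> s" "M \<le> 13 * s"
    and c: "M + s + 30 \<le> 2 * int (card {q \<in> Q. q < 0})"
    and S: "0 \<le> \<Sum>Q"
  shows "{6 * M + 6 + (\<Sum>q\<in>Q. min q 0)..(\<Sum>q\<in>Q. max q 0) - 6 * M - 6} \<subseteq> ssums Q"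
proof -
  define P where "P = {q \<in> Q. 0 < q}"
  define N where "N = {q \<in> Q. q < 0}"
  have fin: "finite Q" by (rule finite_subset[OF Q(1)]) simp
  have "q \<in> N \<or> q \<in> P" if "q \<in> Q" for q using that Q(2) by (cases q "0::int" rule: linorder_cases) (auto simp: P_def N_def)
  then have QPN: "Q = N \<union> P" "N \<inter> P = {}" "finite N" "finite P" using fin by (auto simp: P_def N_def)
  have minN: "(\<Sum>q\<in>Q. min q 0) = \<Sum>N"
  proof -
    have "(\<Sum>q\<in>Q. min q 0) = (\<Sum>q\<in>N. min q 0) + (\<Sum>q\<in>P. min q 0)"
      unfolding QPN(1) by (rule sum.union_disjoint[OF QPN(3,4,2)])
    also have "(\<Sum>q\<in>N. min q 0) = \<Sum>N" by (intro sum.cong) (auto simp: N_def)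
    also have "(\<Sum>q\<in>P. min q 0) = 0" by (intro sum.neutral) (auto simp: P_def)
    finally show ?thesis by simp
  qed
  have maxP: "(\<Sum>q\<in>Q. max q 0) = \<Sum>P"
  proof -
    have "(\<Sum>q\<in>Q. max q 0) = (\<Sum>q\<in>N. max q 0) + (\<Sum>q\<in>P. max q 0)"
      unfolding QPN(1) by (rule sum.union_disjoint[OF QPN(3,4,2)])
    also have "(\<Sum>q\<in>P. max q 0) = \<Sum>P" by (intro sum.cong) (auto simp: P_def)
    also have "(\<Sum>q\<in>N. max q 0) = 0" by (intro sum.neutral) (auto simp: N_def)
    finally show ?thesis by simp
  qed
  have SQ: "\<Sum>Q = \<Sum>N + \<Sum>P" unfolding QPN(1) by (rule sum.union_disjoint[OF QPN(3,4,2)])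
  have "uminus ` N \<subseteq> {1..M}" using Q(1) by (auto simp: N_def)
  moreover have "card (uminus ` N) = card N" by (rule card_image) (simp add: inj_on_def)
  ultimately have pos: "{6 * M + 6..7 * M + 7} \<subseteq> ssums (uminus ` N)"
    using c s by (intro dense_interval[OF M]) (auto simp: N_def)
  have base: "{- (7 * M + 7)..- (6 * M + 6)} \<subseteq> ssums N"
  proof -
    have "s \<in> ssums N" if "s \<in> {- (7 * M + 7)..- (6 * M + 6)}" for s
    proof -
      have "- s \<in> {6 * M + 6..7 * M + 7}" using that by auto
      then have "- s \<in> ssums (uminus ` N)" by (rule subsetD[OF pos])
      then show ?thesis using ssums_uminus[OF QPN(3), of "- s"] by simp
    qed
    then show ?thesis by blast
  qed
  have up: "{- (7 * M + 7)..\<Sum>P - (6 * M + 6)} \<subseteq> ssums Q"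
  proof -
    have "(\<Sum>x\<in>P. min x 0) = 0" by (intro sum.neutral) (auto simp: P_def)
    moreover have "(\<Sum>x\<in>P. max x 0) = \<Sum>P" by (intro sum.cong) (auto simp: P_def)
    moreover have "\<bar>x\<bar> \<le> - (6 * M + 6) - - (7 * M + 7) + 1" if "x \<in> P" for x
    proof -
      have "x \<in> Q" "0 < x" using that by (simp_all add: P_def)
      then have "x \<le> M" using Q(1) by auto
      then show ?thesis using \<open>0 < x\<close> by simp
    qed
    ultimately have "{- (7 * M + 7) + 0..- (6 * M + 6) + \<Sum>P} \<subseteq> ssums (N \<union> P)"
      using ssums_interval_extend[OF QPN(3,4,2) base] by (simp only:)
    moreover have "- (6 * M + 6) + \<Sum>P = \<Sum>P - (6 * M + 6)" by simp
    ultimately show ?thesis by (simp only: QPN(1)[symmetric] add_0_right)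
  qed
  show ?thesis
  proof
    fix x assume x: "x \<in> {6 * M + 6 + (\<Sum>q\<in>Q. min q 0)..(\<Sum>q\<in>Q. max q 0) - 6 * M - 6}"
    show "x \<in> ssums Q"
    proof (cases "- (7 * M + 7) \<le> x")
      case True
      then show ?thesis using x by (intro subsetD[OF up]) (simp add: maxP)
    next
      case False
      with M have "\<Sum>Q - x \<in> {- (7 * M + 7)..\<Sum>P - (6 * M + 6)}"
        using x False S unfolding minN SQ atLeastAtMost_iff by linarith
      then have "\<Sum>Q - x \<in> ssums Q" by (rule subsetD[OF up])
      then have "\<Sum>Q - (\<Sum>Q - x) \<in> ssums Q" by (rule ssums_complement[OF fin])
      then show ?thesis by simp
    qed
  qed
qed

lemma two_sided_interval:
  fixes M :: int
  assumes M: "0 \<le> M" and Q: "Q \<subseteq> {-M..M}" "0 \<notin> Q" and s: "0 \<le> s" "M \<le> 13 * s"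
    and neg: "M + s + 30 \<le> 2 * int (card {q \<in> Q. q < 0})"
    and pos: "M + s + 30 \<le> 2 * int (card {q \<in> Q. 0 < q})"
  shows "{6 * M + 6 + (\<Sum>q\<in>Q. min q 0)..(\<Sum>q\<in>Q. max q 0) - 6 * M - 6} \<subseteq> ssums Q"
proof (cases "0 \<le> \<Sum>Q")
  case True
  then show ?thesis by (rule two_sided_interval_aux[OF M Q s neg])
next
  case False
  have inj: "inj_on uminus A" for A :: "int set" by (simp add: inj_on_def)
  have fin: "finite Q" by (rule finite_subset[OF Q(1)]) simp
  have Q': "uminus ` Q \<subseteq> {-M..M}" "0 \<notin> uminus ` Q" using Q by auto
  have "{q \<in> uminus ` Q. q < 0} = uminus ` {q \<in> Q. 0 < q}" by auto
  then have "card {q \<in> uminus ` Q. q < 0} = card {q \<in> Q. 0 < q}" using card_image[OF inj] by simp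
  then have c: "M + s + 30 \<le> 2 * int (card {q \<in> uminus ` Q. q < 0})" using pos by simp
  have "\<Sum>(uminus ` Q) = - \<Sum>Q" by (simp add: sum.reindex[OF inj] sum_negf)
  then have S: "0 \<le> \<Sum>(uminus ` Q)" using False by simp
  have swap: "(\<Sum>q\<in>uminus ` Q. min q 0) = - (\<Sum>q\<in>Q. max q 0)" "(\<Sum>q\<in>uminus ` Q. max q 0) = - (\<Sum>q\<in>Q. min q 0)"
    unfolding sum.reindex[OF inj] sum_negf[symmetric] by (intro sum.cong refl; simp)+
  show ?thesis
  proof
    fix x assume x: "x \<in> {6 * M + 6 + (\<Sum>q\<in>Q. min q 0)..(\<Sum>q\<in>Q. max q 0) - 6 * M - 6}"
    then have "- x \<in> {6 * M + 6 + (\<Sum>q\<in>uminus ` Q. min q 0)..(\<Sum>q\<in>uminus ` Q. max q 0) - 6 * M - 6}"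
      unfolding swap by auto
    then have "- x \<in> ssums (uminus ` Q)"
      using two_sided_interval_aux[OF M Q' s c S] by blast
    then show "x \<in> ssums Q" using ssums_uminus[OF fin, of "- x"] by simp
  qed
qed

text \<open>The largest of \<open>n\<close> distinct positive integers is at least \<open>n\<close>;
  remove it and induct.\<close>

lemma sum_positive_ints_ge:
  assumes "finite (P :: int set)" "\<And>x. x \<in> P \<Longrightarrow> 0 < x"
  shows "int (card P) * (int (card P) + 1) \<le> 2 * \<Sum>P"
  using assms
proof (induction "card P" arbitrary: P)
  case (Suc n)
  have ne: "P \<noteq> {}" using Suc.hyps(2) by auto
  define m where "m = Max P"
  have m: "m \<in> P" unfolding m_def by (rule Max_in[OF Suc.prems(1) ne])
  have "x \<in> {1..m}" if "x \<in> P" for x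
    using Suc.prems(2)[OF that] Max_ge[OF Suc.prems(1) that] by (simp add: m_def)
  then have "P \<subseteq> {1..m}" by blast
  then have "int (card P) \<le> m" using card_mono[of "{1..m}" P] Suc.prems(2)[OF m] by simp
  have c: "card (P - {m}) = n" using Suc.hyps(2) Suc.prems(1) m by simp
  then have "int n * (int n + 1) \<le> 2 * \<Sum>(P - {m})"
    using Suc.hyps(1)[of "P - {m}"] Suc.prems by blast
  moreover have "\<Sum>P = m + \<Sum>(P - {m})" using sum.remove[OF Suc.prems(1) m] .
  moreover have "int (card P) = int n + 1" using Suc.hyps(2) by simp
  ultimately show ?case using \<open>int (card P) \<le> m\<close> by (simp add: algebra_simps)
next
  case 0
  then have "P = {}" by (metis card_0_eq)
  then show ?case by simp
qed

text \<open>With \<open>a\<close> positive and \<open>b\<close> negative elements the sum is at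
  least \<open>(a^2 + b^2) / 2\<close>, hence at least \<open>(a + b)^2 / 4\<close>.\<close>

lemma sum_abs_ints_ge:
  assumes fin: "finite (Q :: int set)" and "0 \<notin> Q"
  shows "(int (card Q))\<^sup>2 \<le> 4 * (\<Sum>q\<in>Q. \<bar>q\<bar>)"
proof -
  define P where "P = {q \<in> Q. 0 < q}"
  define N where "N = {q \<in> Q. q < 0}"
  have "q \<in> N \<or> q \<in> P" if "q \<in> Q" for q using that assms(2) by (cases q "0::int" rule: linorder_cases) (auto simp: P_def N_def)
  then have Q: "Q = N \<union> P" "N \<inter> P = {}" "finite N" "finite P" using fin by (auto simp: P_def N_def)
  have inj: "inj_on uminus N" by (simp add: inj_on_def)
  have square_le: "(int (card A))\<^sup>2 \<le> 2 * \<Sum>A" if "finite A" "\<And>x. x \<in> A \<Longrightarrow> 0 < x" for A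
  proof -
    have "int (card A) * (int (card A) + 1) \<le> 2 * \<Sum>A" by (rule sum_positive_ints_ge[OF that])
    then show ?thesis unfolding power2_eq_square distrib_left by linarith
  qed
  have P: "(int (card P))\<^sup>2 \<le> 2 * (\<Sum>q\<in>P. \<bar>q\<bar>)"
  proof -
    have "(\<Sum>q\<in>P. \<bar>q\<bar>) = \<Sum>P" by (intro sum.cong) (auto simp: P_def)
    moreover have "(int (card P))\<^sup>2 \<le> 2 * \<Sum>P"
      by (rule square_le) (simp_all add: Q(4) P_def fin)
    ultimately show ?thesis by simp
  qed
  have N: "(int (card N))\<^sup>2 \<le> 2 * (\<Sum>q\<in>N. \<bar>q\<bar>)"
  proof -
    have "(\<Sum>q\<in>N. \<bar>q\<bar>) = \<Sum>(uminus ` N)"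
      unfolding sum.reindex[OF inj] by (intro sum.cong) (auto simp: N_def)
    moreover have "(int (card (uminus ` N)))\<^sup>2 \<le> 2 * \<Sum>(uminus ` N)"
      by (rule square_le) (auto simp: N_def fin)
    ultimately show ?thesis using card_image[OF inj] by simp
  qed
  have "(\<Sum>q\<in>Q. \<bar>q\<bar>) = (\<Sum>q\<in>N. \<bar>q\<bar>) + (\<Sum>q\<in>P. \<bar>q\<bar>)"
    unfolding Q(1) by (rule sum.union_disjoint[OF Q(3,4,2)])
  moreover have "int (card Q) = int (card N) + int (card P)"
    unfolding Q(1) using card_Un_disjoint[OF Q(3,4,2)] by simp
  moreover have "(int (card N) + int (card P))\<^sup>2 \<le> 2 * (int (card N))\<^sup>2 + 2 * (int (card P))\<^sup>2"
    using zero_le_power2[of "int (card N) - int (card P)"]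
    unfolding power2_sum power2_diff by linarith
  ultimately show ?thesis using P N by simp
qed

subsection \<open>Iterated sumsets of symmetric sets of integers\<close>

lemma nfold_mono:
  assumes "0 \<in> Y" "i \<le> j"
  shows "nfold i Y \<subseteq> nfold j Y"
  using assms(2)
proof (induction rule: dec_induct)
  case (step n)
  have "nfold n Y \<subseteq> nfold (Suc n) Y" using sumsetI[OF assms(1)] by fastforce
  then show ?case using step by blast
qed simp

lemma nfold_add:
  assumes "a \<in> nfold i Y" "b \<in> nfold j Y"
  shows "a + b \<in> nfold (i + j) Y"
  using assms(1)
proof (induction i arbitrary: a)
  case 0
  then show ?case using assms(2) by simp
next
  case (Suc i)
  then obtain y c where yc: "y \<in> Y" "c \<in> nfold i Y" "a = y + c" by (auto elim: sumsetE)
  then have "y + (c + b) \<in> sumset Y (nfold (i + j) Y)" using Suc.IH by (intro sumsetI)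
  then show ?case using yc(3) by (simp add: add.assoc)
qed

lemma nfold_uminus:
  assumes "\<And>y. y \<in> Y \<Longrightarrow> - y \<in> Y" "a \<in> nfold i Y"
  shows "- a \<in> nfold i Y"
  using assms(2)
proof (induction i arbitrary: a)
  case (Suc i)
  then obtain y c where yc: "y \<in> Y" "c \<in> nfold i Y" "a = y + c" by (auto elim: sumsetE)
  then have "- y + - c \<in> sumset Y (nfold i Y)" using Suc.IH assms(1) by (intro sumsetI)
  then show ?case using yc(3) by simp
qed simp

lemma finite_sumset:
  assumes fin: "finite A" "finite B"
  shows "finite (sumset A B)"
proof -
  have "sumset A B = (\<lambda>(a, b). a + b) ` (A \<times> B)" by (auto simp: sumset_def)
  then show ?thesis using fin by simp
qed

lemma finite_nfold: "finite Y \<Longrightarrow> finite (nfold j Y)"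
  by (induction j) (simp_all add: finite_sumset)

lemma nfold_abs_le:
  assumes "\<And>y. y \<in> Y \<Longrightarrow> \<bar>y\<bar> \<le> m" "a \<in> nfold j Y"
  shows "\<bar>a\<bar> \<le> int j * m"
  using assms(2)
proof (induction j arbitrary: a)
  case (Suc j)
  then obtain y c where yc: "y \<in> Y" "c \<in> nfold j Y" "a = y + c" by (auto elim: sumsetE)
  then show ?case using Suc.IH[of c] assms(1)[of y] by (simp add: distrib_right)
qed simp

lemma nfold_shift:
  assumes Y: "0 \<in> Y" "M \<in> Y" "- M \<in> Y" and w: "w \<in> nfold i Y" and t: "\<bar>t\<bar> \<le> int n"
  shows "w + t * M \<in> nfold (i + n) Y"
  using t
proof (induction n arbitrary: t)
  case 0
  then show ?case using w by simp
next
  case (Suc n)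
  have ex: "\<exists>e t'. t = e + t' \<and> \<bar>t'\<bar> \<le> int n \<and> e * M \<in> Y"
  proof -
    consider "t < 0" | "t = 0" | "t > 0" by linarith
    then show ?thesis
    proof cases
      case 1
      then show ?thesis using Suc.prems Y by (intro exI[of _ "-1"] exI[of _ "t + 1"]) auto
    next
      case 2
      then show ?thesis using Y by (intro exI[of _ 0] exI[of _ 0]) auto
    next
      case 3
      then show ?thesis using Suc.prems Y by (intro exI[of _ 1] exI[of _ "t - 1"]) auto
    qed
  qed
  then obtain e t' where e: "t = e + t'" "\<bar>t'\<bar> \<le> int n" "e * M \<in> Y" by blast
  have "e * M + (w + t' * M) \<in> sumset Y (nfold (i + n) Y)"
    by (rule sumsetI[OF e(3) Suc.IH[OF e(2)]])
  then show ?case by (simp add: e(1) algebra_simps)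
qed

definition residues_of :: "int \<Rightarrow> int set \<Rightarrow> int set" where
  "residues_of M W = {z. \<exists>w\<in>W. [z = w] (mod M)}"

lemma periodic_residues_of: "periodic M (residues_of M W)"
proof (rule periodicI)
  fix x
  have "[x + M = w] (mod M) \<longleftrightarrow> [x = w] (mod M)" for w by (simp add: cong_def)
  then show "x + M \<in> residues_of M W \<longleftrightarrow> x \<in> residues_of M W" by (simp add: residues_of_def)
qed

lemma residues_ofI: "w \<in> W \<Longrightarrow> [z = w] (mod M) \<Longrightarrow> z \<in> residues_of M W"
  unfolding residues_of_def by blast

text \<open>Lift every class occurring in \<open>nfold i Y\<close> to an integer and translate it by
  \<open>t * M\<close> with \<open>\<bar>t\<bar> \<le> j - i\<close>. All these integers lie in
  \<open>nfold j Y\<close>, and they are distinct: the class determines the lift, and then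
  \<open>t\<close>.\<close>

lemma card_nfold_ge:
  assumes Y: "finite Y" "0 \<in> Y" "M \<in> Y" "- M \<in> Y" and M: "0 < M" and "i \<le> j"
  shows "(2 * (j - i) + 1) * rcard M (residues_of M (nfold i Y)) \<le> card (nfold j Y)"
proof -
  let ?Z = "residues_of M (nfold i Y) \<inter> {0..<M}" and ?T = "{- int (j - i)..int (j - i)}"
  obtain w where w: "\<And>z. z \<in> ?Z \<Longrightarrow> w z \<in> nfold i Y \<and> [z = w z] (mod M)"
  proof -
    have "\<forall>z\<in>?Z. \<exists>w. w \<in> nfold i Y \<and> [z = w] (mod M)" by (auto simp: residues_of_def)
    then obtain w where "\<forall>z\<in>?Z. w z \<in> nfold i Y \<and> [z = w z] (mod M)" by (rule bchoice[THEN exE])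
    then show ?thesis using that by blast
  qed
  let ?f = "\<lambda>(z, t). w z + t * M"
  have inj: "inj_on ?f (?Z \<times> ?T)"
  proof (rule inj_onI, clarify)
    fix z t z' t'
    assume z: "z \<in> residues_of M (nfold i Y)" "z \<in> {0..<M}" "z' \<in> residues_of M (nfold i Y)" "z' \<in> {0..<M}"
      and eq: "w z + t * M = w z' + t' * M"
    have "[z = w z + t * M] (mod M)" using w[of z] z by (simp add: cong_def)
    moreover have "[w z' + t' * M = z'] (mod M)" using w[of z'] z by (simp add: cong_def)
    ultimately have "[z = z'] (mod M)" unfolding eq by (rule cong_trans)
    then have "z = z'" using z by (simp add: cong_def)
    then show "z = z' \<and> t = t'" using eq M by simp
  qed
  have "card (?f ` (?Z \<times> ?T)) = rcard M (residues_of M (nfold i Y)) * (2 * (j - i) + 1)"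
  proof -
    have "card ?T = 2 * (j - i) + 1" by (simp add: nat_add_distrib nat_mult_distrib)
    then show ?thesis using card_image[OF inj]
      by (simp add: rcard_def card_cartesian_product)
  qed
  moreover have "?f ` (?Z \<times> ?T) \<subseteq> nfold j Y"
  proof
    fix x assume "x \<in> ?f ` (?Z \<times> ?T)"
    then obtain z t where zt: "z \<in> ?Z" "t \<in> ?T" "x = w z + t * M" by auto
    have "\<bar>t\<bar> \<le> int (j - i)" using zt(2) by auto
    then have "w z + t * M \<in> nfold (i + (j - i)) Y"
      using w[OF zt(1)] by (intro nfold_shift[OF Y(2-4)]) auto
    then show "x \<in> nfold j Y" using zt(3) \<open>i \<le> j\<close> by simp
  qed
  then have "card (?f ` (?Z \<times> ?T)) \<le> card (nfold j Y)" by (intro card_mono finite_nfold[OF Y(1)])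
  ultimately show ?thesis by (simp add: mult.commute)
qed

text \<open>A class modulo \<open>M\<close> has one representative in \<open>{0..<M}\<close> and one
  in \<open>{-M..<0}\<close>; only the point \<open>M\<close> remains.\<close>

lemma card_le_rcard:
  assumes M: "0 < M" and Y: "Y \<subseteq> {-M..M}"
  shows "card Y \<le> 2 * rcard M (residues_of M Y) + 1"
proof -
  let ?B = "residues_of M Y \<inter> {0..<M}"
  have "Y \<subseteq> insert M (?B \<union> (\<lambda>z. z - M) ` ?B)"
  proof
    fix y assume y: "y \<in> Y"
    then have "- M \<le> y" "y \<le> M" using Y by auto
    moreover have "y \<in> residues_of M Y" "y + M \<in> residues_of M Y"
      using y by (auto intro!: residues_ofI[OF y] simp: cong_def)
    moreover have "y = (y + M) - M" by simp
    ultimately show "y \<in> insert M (?B \<union> (\<lambda>z. z - M) ` ?B)"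
      by (cases "y = M"; cases "0 \<le> y") (auto intro!: image_eqI[of _ _ "y + M"])
  qed
  then have "card Y \<le> card (insert M (?B \<union> (\<lambda>z. z - M) ` ?B))" by (intro card_mono) auto
  also have "\<dots> \<le> Suc (card (?B \<union> (\<lambda>z. z - M) ` ?B))" by (rule card_insert_le_m1) simp_all
  also have "card (?B \<union> (\<lambda>z. z - M) ` ?B) \<le> card ?B + card ((\<lambda>z. z - M) ` ?B)" by (rule card_Un_le)
  also have "card ((\<lambda>z. z - M) ` ?B) \<le> card ?B" by (rule card_image_le) simp
  finally show ?thesis by (simp add: rcard_def)
qed

lemma nfold_1: "nfold 1 Y = Y"
  by (auto simp: sumset_def)

text \<open>Modulo the largest element \<open>M\<close>, either the four-fold sums fill at least
  twice as many classes as \<open>Y\<close>, and lifting contradicts \<open>small\<close>; or the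
  two-fold sums already form a subgroup. It is generated by a divisor \<open>d\<close> of
  \<open>M\<close>, and its \<open>m\<close> classes are lifted likewise. The factors are
  \<open>2 * (n - 4) + 1 = 2 * n - 7\<close> and \<open>2 * (n - 2) + 1 = 2 * n - 3\<close>.\<close>

lemma nfold_structure:
  assumes Y: "finite Y" "0 \<in> Y" "M \<in> Y" "Y \<subseteq> {-M..M}" "\<And>y. y \<in> Y \<Longrightarrow> - y \<in> Y" and M: "0 < M"
    and n: "4 \<le> n" and small: "card (nfold n Y) < (2 * n - 7) * (card Y - 1)"
  shows "\<exists>d m. 0 < d \<and> M = d * m \<and> (\<forall>y\<in>Y. d dvd y) \<and> (2 * n - 3) * nat m \<le> card (nfold n Y)"
proof -
  define B where "B i = residues_of M (nfold i Y)" for i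
  have perB: "periodic M (B i)" for i unfolding B_def by (rule periodic_residues_of)
  have Bmono: "B i \<subseteq> B j" if "i \<le> j" for i j
    using nfold_mono[OF Y(2) that] unfolding B_def residues_of_def by blast
  have Badd: "a + b \<in> B (i + j)" if ab: "a \<in> B i" "b \<in> B j" for a b i j
  proof -
    obtain v w where vw: "v \<in> nfold i Y" "[a = v] (mod M)" "w \<in> nfold j Y" "[b = w] (mod M)"
      using ab unfolding B_def residues_of_def by blast
    then show ?thesis unfolding B_def
      by (intro residues_ofI[OF nfold_add[OF vw(1,3)]] cong_add)
  qed
  have Bneg: "- a \<in> B i" if a: "a \<in> B i" for a i
  proof -
    obtain v where v: "v \<in> nfold i Y" "[a = v] (mod M)"
      using a unfolding B_def residues_of_def by blast
    show ?thesis unfolding B_def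
      by (rule residues_ofI[OF nfold_uminus[OF Y(5) v(1)]]) (use v(2) in \<open>simp_all add: cong_minus_minus_iff\<close>)
  qed
  have B0: "0 \<in> B i" for i
    using nfold_mono[OF Y(2), of 0 i] unfolding B_def by (intro residues_ofI[of 0]) auto
  have YB: "y \<in> B 1" if "y \<in> Y" for y
    unfolding B_def nfold_1 by (rule residues_ofI[OF that cong_refl])
  have Mneg: "- M \<in> Y" by (rule Y(5)[OF Y(3)])
  \<comment> \<open>An element at word distance 3 would yield two disjoint translates of the unit ball inside the 4-ball.\<close>
  have "B 3 \<subseteq> B 2"
  proof (rule ccontr)
    assume "\<not> B 3 \<subseteq> B 2"
    then obtain z where z: "z \<in> B 3" "z \<notin> B 2" by blast
    have "B 1 \<inter> {x. x + (- z) \<in> B 1} = {}"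
    proof (rule ccontr)
      assume "B 1 \<inter> {x. x + (- z) \<in> B 1} \<noteq> {}"
      then obtain x where "x \<in> B 1" "x + (- z) \<in> B 1" by blast
      then have "x + - (x + (- z)) \<in> B (1 + 1)" by (intro Badd Bneg)
      then show False using z(2) by (simp add: numeral_2_eq_2)
    qed
    then have "rcard M (B 1) + rcard M {x. x + (- z) \<in> B 1} = rcard M (B 1 \<union> {x. x + (- z) \<in> B 1})"
      by (rule rcard_Un_disjoint[symmetric])
    also have "\<dots> \<le> rcard M (B 4)"
    proof (rule rcard_mono, rule Un_least)
      show "B 1 \<subseteq> B 4" by (rule Bmono) simp
      show "{x. x + (- z) \<in> B 1} \<subseteq> B 4"
      proof
        fix x assume "x \<in> {x. x + (- z) \<in> B 1}"
        then have "(x + (- z)) + z \<in> B (1 + 3)" using z(1) by (intro Badd) auto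
        then show "x \<in> B 4" by simp
      qed
    qed
    finally have "2 * rcard M (B 1) \<le> rcard M (B 4)" using rcard_translate[OF M perB[of 1], of "- z"] by linarith
    then have "(2 * (n - 4) + 1) * (2 * rcard M (B 1)) \<le> card (nfold n Y)"
      using card_nfold_ge[OF Y(1-3) Mneg M n] unfolding B_def
      by (meson le_trans mult_le_mono2)
    moreover have "card Y - 1 \<le> 2 * rcard M (B 1)"
      using card_le_rcard[OF M Y(4)] unfolding B_def nfold_1 by linarith
    then have "(2 * (n - 4) + 1) * (card Y - 1) \<le> (2 * (n - 4) + 1) * (2 * rcard M (B 1))"
      by (rule mult_le_mono2)
    ultimately have "(2 * (n - 4) + 1) * (card Y - 1) \<le> card (nfold n Y)" by (rule le_trans[rotated])
    moreover have "2 * (n - 4) + 1 = 2 * n - 7" using n by simp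
    ultimately show False using small not_le by metis
  qed
  have Yadd: "y + a \<in> B 2" if "y \<in> Y" "a \<in> B 2" for y a
  proof -
    have "y + a \<in> B (1 + 2)" by (rule Badd[OF YB[OF that(1)] that(2)])
    then show ?thesis using \<open>B 3 \<subseteq> B 2\<close> by (auto simp: eval_nat_numeral)
  qed
  \<comment> \<open>Stability under adding elements of \<open>Y\<close> suffices, since each class
    in \<open>B 2\<close> is that of a sum of two of them.\<close>
  have add: "a + b \<in> B 2" if ab: "a \<in> B 2" "b \<in> B 2" for a b
  proof -
    obtain w where w: "w \<in> nfold 2 Y" "[b = w] (mod M)"
      using ab(2) unfolding B_def residues_of_def by blast
    have "nfold 2 Y = sumset Y (nfold 1 Y)" by (simp add: numeral_2_eq_2)
    then obtain y1 y2 where y: "y1 \<in> Y" "y2 \<in> Y" "w = y1 + y2"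
      using w(1) unfolding nfold_1 by (auto elim: sumsetE)
    have "y1 + (y2 + a) \<in> B 2" by (intro Yadd y ab(1))
    moreover have "[a + b = y1 + (y2 + a)] (mod M)"
      using cong_add[OF cong_refl[of a] w(2)] y(3) by (simp add: ac_simps)
    ultimately show ?thesis using periodic_cong[OF perB] by blast
  qed
  have mult_nat: "int k * a \<in> B 2" if "a \<in> B 2" for a k
  proof (induction k)
    case (Suc k)
    have "int (Suc k) * a = a + int k * a" by (simp add: distrib_right)
    then show ?case using add[OF that Suc] by simp
  qed (simp add: B0)
  have mult: "k * a \<in> B 2" if "a \<in> B 2" for a k
  proof (cases "0 \<le> k")
    case True
    then show ?thesis using mult_nat[OF that, of "nat k"] by simp
  next
    case False
    then show ?thesis using Bneg[OF mult_nat[OF that, of "nat (- k)"]] by simp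
  qed
  have MB: "M \<in> B 2" using Bmono[of 1 2] YB[OF Y(3)] by auto
  define P where "P k \<longleftrightarrow> 0 < k \<and> int k \<in> B 2" for k
  \<comment> \<open>The least positive element; division with remainder shows that it divides every
    element of \<open>B 2\<close>, among them \<open>M\<close>.\<close>
  define d where "d = int (LEAST k. P k)"
  have "P (nat M)" using M MB by (simp add: P_def)
  then have "P (LEAST k. P k)" by (rule LeastI)
  then have d: "0 < d" "d \<in> B 2" by (simp_all add: d_def P_def)
  have dvd: "d dvd a" if "a \<in> B 2" for a
  proof -
    have "a + (- (a div d)) * d \<in> B 2" by (intro add that mult d(2))
    moreover have "a + (- (a div d)) * d = a mod d" by (simp add: minus_div_mult_eq_mod[symmetric])
    ultimately have mB: "a mod d \<in> B 2" by simp
    have "\<not> 0 < a mod d"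
    proof
      assume "0 < a mod d"
      then have "P (nat (a mod d))" using mB by (simp add: P_def)
      then have "(LEAST k. P k) \<le> nat (a mod d)" by (rule Least_le)
      then have "d \<le> a mod d" using \<open>0 < a mod d\<close> by (simp add: d_def)
      then show False using pos_mod_bound[OF d(1), of a] by simp
    qed
    then have "a mod d = 0" using pos_mod_sign[OF d(1), of a] by linarith
    then show ?thesis by (rule dvd_eq_mod_eq_0[THEN iffD2])
  qed
  obtain m where m: "M = d * m" using dvd[OF MB] by (elim dvdE)
  have "(\<lambda>i. d * i) ` {0..<m} \<subseteq> B 2 \<inter> {0..<M}"
  proof
    fix x assume "x \<in> (\<lambda>i. d * i) ` {0..<m}"
    then obtain i where i: "0 \<le> i" "i < m" "x = d * i" by auto
    have "d * i < d * m" using i(2) d(1) by simp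
    then show "x \<in> B 2 \<inter> {0..<M}" using i d mult[OF d(2), of i] m by (simp add: mult.commute)
  qed
  then have "card ((\<lambda>i. d * i) ` {0..<m}) \<le> rcard M (B 2)" unfolding rcard_def by (intro card_mono) auto
  moreover have "card ((\<lambda>i. d * i) ` {0..<m}) = nat m"
    using d(1) by (subst card_image) (auto simp: inj_on_def)
  ultimately have "(2 * (n - 2) + 1) * nat m \<le> (2 * (n - 2) + 1) * rcard M (B 2)" by (intro mult_le_mono2) simp
  also have "\<dots> \<le> card (nfold n Y)"
    unfolding B_def using n by (intro card_nfold_ge[OF Y(1-3) Mneg M]) simp
  finally have "(2 * (n - 2) + 1) * nat m \<le> card (nfold n Y)" .
  moreover have "2 * (n - 2) + 1 = 2 * n - 3" using n by simp
  ultimately have "(2 * n - 3) * nat m \<le> card (nfold n Y)" by (simp only:)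
  moreover have "\<forall>y\<in>Y. d dvd y" using dvd YB Bmono[of 1 2] by auto
  ultimately show ?thesis using d(1) m by blast
qed

subsection \<open>Greedy growth of subset sums\<close>

text \<open>Increments proportional to the number of remaining elements telescope to a difference of
  squares, by \<open>x^2 - (x - 1)^2 \<le> 2 * x\<close>.\<close>

lemma increments_sum:
  fixes c :: "nat \<Rightarrow> nat" and s r :: int
  assumes "0 \<le> s" "a \<le> b" "b \<le> N"
    and inc: "\<And>i. a \<le> i \<Longrightarrow> i < b \<Longrightarrow> 2 * s * int (N - i) \<le> r * (int (c (Suc i)) - int (c i))"
  shows "s * ((int N - int a)\<^sup>2 - (int N - int b)\<^sup>2) \<le> r * (int (c b) - int (c a))"
  using assms(2-4)
proof (induction rule: dec_induct)
  case (step n)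
  have IH: "s * ((int N - int a)\<^sup>2 - (int N - int n)\<^sup>2) \<le> r * (int (c n) - int (c a))"
    by (rule step.IH) (use step in auto)
  define x where "x = int N - int n"
  have "int (N - n) = x" using step by (simp add: x_def of_nat_diff)
  then have "2 * s * x \<le> r * (int (c (Suc n)) - int (c n))" using step.prems(2)[of n] step.hyps by simp
  moreover have "s * (x\<^sup>2 - (x - 1)\<^sup>2) \<le> 2 * s * x" using assms(1) by (simp add: power2_eq_square algebra_simps)
  moreover have "int N - int (Suc n) = x - 1" by (simp add: x_def)
  ultimately show ?case using IH unfolding x_def[symmetric] by (simp add: algebra_simps)
qed simp

text \<open>\<open>P\<close> is the prime, \<open>100 * L\<close> the number of elements, and
  \<open>c i\<close> the number of sums after \<open>i\<close> greedy steps. The first two bounds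
  place \<open>100 * L\<close> between \<open>sqrt (3.95 * P)\<close> and \<open>2 * sqrt P\<close>.
  \<open>gain\<close> is \<open>lam_growth\<close>, with \<open>J * h + c i \<le> P\<close>
  expressing the size of the complement.\<close>

locale growth =
  fixes P L :: nat and c :: "nat \<Rightarrow> nat"
  assumes P_upper: "395 * P \<le> 1000000 * L\<^sup>2" and P_lower: "10000 * L\<^sup>2 \<le> 4 * P"
    and L: "160000 \<le> L"
    and c_less: "\<And>i. i \<le> 100 * L \<Longrightarrow> c i < P"
    and increasing: "\<And>i. i < 100 * L \<Longrightarrow> c i < c (Suc i)"
    and gain: "\<And>i h J. \<lbrakk>i < 100 * L; 1 \<le> h; 2 * h \<le> 100 * L - i; 1 \<le> J; J * h \<le> c i; J * h + c i \<le> P\<rbrakk>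
      \<Longrightarrow> h * (J - 1) \<le> (c (Suc i) - c i) * J"
begin

lemma P_large: "400000000 * L \<le> P"
proof -
  have "160000 * L \<le> L\<^sup>2" unfolding power2_eq_square by (rule mult_le_mono1[OF L])
  then show ?thesis using P_lower by linarith
qed

lemma c_mono: "i \<le> j \<Longrightarrow> j \<le> 100 * L \<Longrightarrow> c i + (j - i) \<le> c j"
proof (induction rule: dec_induct)
  case (step n)
  then show ?case using increasing[of n] by simp
qed simp

text \<open>The crude choice \<open>h = 40000\<close>, \<open>J = 2\<close>, which asks only for
  \<open>80000\<close> sums present and \<open>80000\<close> missing.\<close>

lemma gain_small:
  assumes "i + 80000 \<le> 100 * L" "80000 \<le> c i" "80000 + c i \<le> P"
  shows "c i + 20000 \<le> c (Suc i)"
proof -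
  have "40000 * (2 - 1) \<le> (c (Suc i) - c i) * 2"
    by (rule gain) (use assms in auto)
  moreover have "c i < c (Suc i)" using assms(1) by (intro increasing) linarith
  ultimately show ?thesis by linarith
qed

text \<open>After \<open>80000\<close> steps of gain at least one, \<open>gain_small\<close> applies
  and \<open>L div 2\<close> further steps suffice; \<open>L \<ge> 160000\<close> lets this finish
  by step \<open>L\<close>. The target \<open>5000 * L\<close> is what \<open>J = 100\<close>
  demands in \<open>gain_main\<close>.\<close>

lemma early_lower_bound:
  assumes "L \<le> i" "i \<le> 100 * L"
  shows "5000 * L \<le> c i"
proof -
  have claim: "min (5000 * L) (20000 * t) \<le> c (80000 + t)" if "t \<le> L" for t
    using that
  proof (induction t)
    case (Suc t)
    have base: "80000 \<le> c (80000 + t)" using c_mono[of 0 "80000 + t"] Suc.prems L by simp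
    have IH: "min (5000 * L) (20000 * t) \<le> c (80000 + t)" using Suc by simp
    have lt: "c (80000 + t) < c (Suc (80000 + t))" using increasing[of "80000 + t"] Suc.prems L by simp
    show ?case
    proof (cases "5000 * L \<le> c (80000 + t)")
      case True
      then show ?thesis using lt by simp
    next
      case False
      then have "c (80000 + t) + 20000 \<le> c (Suc (80000 + t))"
        using base P_large Suc.prems L by (intro gain_small) auto
      then show ?thesis using IH False by (simp add: min_def split: if_splits)
    qed
  qed simp
  have "min (5000 * L) (20000 * (L div 2)) \<le> c (80000 + L div 2)" by (rule claim) simp
  moreover have "5000 * L \<le> 20000 * (L div 2)" using L by linarith
  ultimately have "5000 * L \<le> c (80000 + L div 2)" by simp
  also have "80000 + L div 2 \<le> L" using L by linarith
  then have "80000 + L div 2 \<le> i" using assms by simp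
  then have "c (80000 + L div 2) \<le> c i" using c_mono[of "80000 + L div 2" i] assms by simp
  finally show ?thesis .
qed

text \<open>Mirror image of the early phase: otherwise \<open>L div 2\<close> steps of gain
  \<open>20000\<close> would leave at most \<open>80000\<close> residues missing, and
  \<open>80000\<close> steps of gain one would fill these before step
  \<open>100 * L\<close>.\<close>

lemma late_upper_bound:
  assumes "i \<le> 99 * L"
  shows "5000 * L + c i \<le> P"
proof (rule ccontr)
  assume neg: "\<not> 5000 * L + c i \<le> P"
  have claim: "P \<le> max (c (i + t) + 80000) (c (i + t) + (5000 * L - 20000 * t))" if "t \<le> L div 2" for t
    using that
  proof (induction t)
    case 0
    then show ?case using neg by simp
  next
    case (Suc t)
    have IH: "P \<le> max (c (i + t) + 80000) (c (i + t) + (5000 * L - 20000 * t))" using Suc by simp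
    have lt: "c (i + t) < c (Suc (i + t))" using increasing[of "i + t"] Suc.prems L assms by simp
    show ?case
    proof (cases "P < c (i + t) + 80000")
      case True
      then show ?thesis using lt by simp
    next
      case False
      have "i + t \<le> 100 * L" using Suc.prems assms by linarith
      then have "c i \<le> c (i + t)" using c_mono[of i "i + t"] by simp
      then have "80000 \<le> c (i + t)" using neg P_large L by simp
      then have "c (i + t) + 20000 \<le> c (Suc (i + t))"
        using False Suc.prems assms L by (intro gain_small) auto
      then show ?thesis using IH by auto
    qed
  qed
  have "5000 * L \<le> 20000 * (L div 2)" using L by linarith
  then have "P \<le> c (i + L div 2) + 80000" using claim[of "L div 2"] by simp
  moreover have "c (i + L div 2) + 80000 \<le> c (i + L div 2 + 80000)"
    using c_mono[of "i + L div 2" "i + L div 2 + 80000"] assms L by simp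
  moreover have "c (i + L div 2 + 80000) < P" by (rule c_less) (use assms L in linarith)
  ultimately show False by simp
qed

text \<open>\<open>gain\<close> with \<open>h = x div 2\<close> and \<open>J = 100\<close>.
  Weakening \<open>99 / 100\<close> to \<open>98 / 100\<close> absorbs the rounding in
  \<open>h\<close>.\<close>

lemma gain_main:
  assumes "L \<le> i" "i < 99 * L"
  shows "2 * 49 * int (100 * L - i) \<le> 200 * (int (c (Suc i)) - int (c i))"
proof -
  define x where "x = 100 * L - i"
  define h where "h = x div 2"
  define k where "k = c (Suc i) - c i"
  have h: "2 * h \<le> x" "x \<le> 2 * h + 1" by (auto simp: h_def)
  have x: "L \<le> x" "x \<le> 100 * L" using assms by (auto simp: x_def)
  have "100 * h \<le> 5000 * L" using h(1) x by linarith
  moreover have "5000 * L \<le> c i" "5000 * L + c i \<le> P" using early_lower_bound[of i] late_upper_bound[of i] assms by simp_all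
  ultimately have "h * (100 - 1) \<le> k * 100"
    unfolding k_def using assms h L x by (intro gain) (auto simp: x_def)
  then have "99 * h \<le> 100 * k" by simp
  then have "98 * x \<le> 200 * k" using h x L by linarith
  then have "98 * int x \<le> 200 * int k" by linarith
  moreover have "int (c (Suc i)) - int (c i) = int k" using increasing[of i] assms by (simp add: k_def)
  ultimately show ?thesis by (simp add: x_def)
qed

lemma total_growth:
  assumes "L \<le> a" "a \<le> b" "b \<le> 99 * L"
  shows "49 * ((100 * int L - int a)\<^sup>2 - (100 * int L - int b)\<^sup>2) \<le> 200 * (int (c b) - int (c a))"
proof -
  have "49 * ((int (100 * L) - int a)\<^sup>2 - (int (100 * L) - int b)\<^sup>2) \<le> 200 * (int (c b) - int (c a))"
  proof (rule increments_sum)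
    show "2 * 49 * int (100 * L - i) \<le> 200 * (int (c (Suc i)) - int (c i))" if "a \<le> i" "i < b" for i
      by (rule gain_main) (use that assms in linarith)+
  qed (use assms in auto)
  then show ?thesis by simp
qed

lemma P_bound: "395 * int P \<le> 1000000 * (int L)\<^sup>2"
proof -
  have "int (395 * P) \<le> int (1000000 * L\<^sup>2)" using P_upper by (simp only: of_nat_le_iff)
  then show ?thesis by simp
qed

text \<open>The constants round down \<open>49 / 200 * (99^2 - 95^2) = 190.12\<close> and
  \<open>49 / 200 * (75^2 - 1) = 1377.88\<close>.\<close>

lemma growth_bounds:
  "190 * (int L)\<^sup>2 \<le> int (c (5 * L)) - int (c L)"
  "1377 * (int L)\<^sup>2 \<le> int (c (99 * L)) - int (c (25 * L))"
proof -
  have sq: "(100 * int L - int (a * L))\<^sup>2 = (100 - int a)\<^sup>2 * (int L)\<^sup>2" for a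
    by (simp add: left_diff_distrib[symmetric] power_mult_distrib)
  have "49 * ((100 * int L - int (1 * L))\<^sup>2 - (100 * int L - int (5 * L))\<^sup>2) \<le> 200 * (int (c (5 * L)) - int (c (1 * L)))"
    by (rule total_growth) simp_all
  then have "38024 * (int L)\<^sup>2 \<le> 200 * int (c (5 * L)) - 200 * int (c L)" unfolding sq by simp
  then show "190 * (int L)\<^sup>2 \<le> int (c (5 * L)) - int (c L)"
    using zero_le_power2[of "int L"] by linarith
  have "49 * ((100 * int L - int (25 * L))\<^sup>2 - (100 * int L - int (99 * L))\<^sup>2) \<le> 200 * (int (c (99 * L)) - int (c (25 * L)))"
    by (rule total_growth) simp_all
  then have "275576 * (int L)\<^sup>2 \<le> 200 * int (c (99 * L)) - 200 * int (c (25 * L))" unfolding sq by simp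
  then show "1377 * (int L)\<^sup>2 \<le> int (c (99 * L)) - int (c (25 * L))"
    using zero_le_power2[of "int L"] by linarith
qed

text \<open>Were all these steps fast, they would add \<open>3 / 10 * (95^2 - 75^2) = 1020\<close>
  times \<open>L^2\<close>. With the phases before and after, the total reaches
  \<open>2587 * L^2\<close>, whereas \<open>P\<close> is below \<open>2532 * L^2\<close>.\<close>

lemma exists_slow_step:
  "\<exists>i\<ge>5 * L. i < 25 * L \<and> 10 * (c (Suc i) - c i) \<le> 6 * (100 * L - i)"
proof (rule ccontr)
  assume neg: "\<not> ?thesis"
  have sq: "(int (100 * L) - int (a * L))\<^sup>2 = (100 - int a)\<^sup>2 * (int L)\<^sup>2" for a
    by (simp add: left_diff_distrib[symmetric] power_mult_distrib)
  have "3 * ((int (100 * L) - int (5 * L))\<^sup>2 - (int (100 * L) - int (25 * L))\<^sup>2) \<le> 10 * (int (c (25 * L)) - int (c (5 * L)))"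
  proof (rule increments_sum)
    fix i assume i: "5 * L \<le> i" "i < 25 * L"
    have "6 * (100 * L - i) < 10 * (c (Suc i) - c i)" using neg i by (meson not_le)
    then have "6 * int (100 * L - i) < 10 * int (c (Suc i) - c i)"
      by (metis of_nat_less_iff of_nat_mult of_nat_numeral)
    moreover have "c i < c (Suc i)" using i by (intro increasing) linarith
    then have "int (c (Suc i)) - int (c i) = int (c (Suc i) - c i)" by simp
    moreover have "6 * int x < 10 * int k \<Longrightarrow> d = int k \<Longrightarrow> 2 * 3 * int x \<le> 10 * d" for x k d by linarith
    ultimately show "2 * 3 * int (100 * L - i) \<le> 10 * (int (c (Suc i)) - int (c i))" by blast
  qed auto
  then have "1020 * (int L)\<^sup>2 \<le> int (c (25 * L)) - int (c (5 * L))" unfolding sq by simp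
  moreover have "int (c (99 * L)) < int P" using c_less[of "99 * L"] by simp
  moreover have "0 \<le> (int L)\<^sup>2" by simp
  ultimately show False using growth_bounds P_bound by linarith
qed

text \<open>At these steps at least \<open>190 * L^2\<close> residues are present and at least
  \<open>1377 * L^2\<close> are missing; both exceed \<open>P / 20\<close>.\<close>

lemma middle_density:
  assumes "5 * L \<le> i" "i \<le> 25 * L"
  shows "P \<le> 20 * c i" "P + 20 * c i \<le> 20 * P"
proof -
  have sq: "0 \<le> (int L)\<^sup>2" by simp
  have "c (5 * L) \<le> c i" using c_mono[of "5 * L" i] assms by simp
  then have "int P \<le> 20 * int (c i)" using P_bound sq growth_bounds(1) by linarith
  then show "P \<le> 20 * c i" by linarith
  have "c i \<le> c (25 * L)" using c_mono[of i "25 * L"] assms by simp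
  moreover have "c (99 * L) < P" by (rule c_less) simp
  ultimately have "int P + 20 * int (c i) \<le> 20 * int P" using P_bound sq growth_bounds(2) by linarith
  then show "P + 20 * c i \<le> 20 * P" by linarith
qed

end

section \<open>The greedy chain of subsets\<close>

lemma residues_ssums_insert:
  assumes "finite B" "x \<notin> B"
  shows "residues_of p (ssums (insert x B)) = residues_of p (ssums B) \<union> {y. y + (- x) \<in> residues_of p (ssums B)}"
proof -
  have "[y = s + x] (mod p) \<longleftrightarrow> [y + (- x) = s] (mod p)" for y s
    by (simp add: cong_iff_dvd_diff algebra_simps)
  then show ?thesis
    unfolding residues_of_def ssums_insert[OF assms] by auto
qed

lemma rcard_ssums_insert:
  assumes p: "0 < p" and "finite B" "x \<notin> B"
  shows "rcard p (residues_of p (ssums (insert x B)))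
    = rcard p (residues_of p (ssums B)) + lam p (residues_of p (ssums B)) x"
proof -
  let ?S = "residues_of p (ssums B)"
  let ?D = "{y. y + (- x) \<in> {s \<in> ?S. s + x \<notin> ?S}}"
  have S: "periodic p ?S" by (rule periodic_residues_of)
  have "residues_of p (ssums (insert x B)) = ?S \<union> ?D"
    unfolding residues_ssums_insert[OF assms(2,3)] by auto
  moreover have "rcard p (?S \<union> ?D) = rcard p ?S + rcard p ?D"
    by (rule rcard_Un_disjoint) auto
  moreover have "rcard p ?D = lam p ?S x"
    unfolding lam_def by (rule rcard_translate[OF p periodic_lam_set[OF S]])
  ultimately show ?thesis by simp
qed

lemma lam_pos:
  assumes p: "prime p" and S: "periodic p S" "a \<in> S" "S \<noteq> UNIV" and x: "\<not> p dvd x"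
  shows "0 < lam p S x"
proof (rule ccontr)
  assume "\<not> 0 < lam p S x"
  then have "{s \<in> S. s + x \<notin> S} = {}"
    unfolding lam_def using rcard_zeroD[OF prime_gt_0_int[OF p] periodic_lam_set[OF S(1)]] by simp
  then have "s + x \<in> S" if "s \<in> S" for s using that by blast
  then have "S = UNIV" by (rule closed_under_shift_UNIV[OF p S(1) x S(2)])
  then show False using S(3) by simp
qed

lemma not_dvd_residue:
  assumes "x \<in> {1..<p::int}"
  shows "\<not> p dvd x"
  using assms zdvd_imp_le[of p x] by auto

lemma residues_of_mono: "A \<subseteq> B \<Longrightarrow> residues_of p A \<subseteq> residues_of p B"
  unfolding residues_of_def by blast

lemma zero_in_ssums: "0 \<in> residues_of p (ssums B)"
proof (rule residues_ofI)
  show "\<Sum>{} \<in> ssums B" unfolding ssums_def by blast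
qed simp

text \<open>Always adjoining an element of largest \<open>lam\<close> yields a chain satisfying the
  axioms of \<open>growth\<close>. At its slow step, maximality turns the small gain into a bound
  for all remaining elements.\<close>

lemma exists_slow_subset:
  assumes p: "prime p" and A: "A \<subseteq> {1..<p}" "card A = 100 * L"
    and L: "160000 \<le> L" "395 * nat p \<le> 1000000 * L\<^sup>2" "10000 * L\<^sup>2 \<le> 4 * nat p"
    and incomplete: "residues_of p (ssums A) \<noteq> UNIV"
  shows "\<exists>B k. B \<subseteq> A \<and> 75 * L \<le> card (A - B) \<and> card (A - B) \<le> 95 * L \<and> 10 * k \<le> 6 * card (A - B)
    \<and> (\<forall>x\<in>A - B. lam p (residues_of p (ssums B)) x \<le> k)
    \<and> nat p \<le> 20 * rcard p (residues_of p (ssums B))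
    \<and> nat p + 20 * rcard p (residues_of p (ssums B)) \<le> 20 * nat p"
proof -
  have p0: "0 < p" by (rule prime_gt_0_int[OF p])
  have fin: "finite A" by (rule finite_subset[OF A(1)]) simp
  define S where "S B = residues_of p (ssums B)" for B
  have perS: "periodic p (S B)" for B unfolding S_def by (rule periodic_residues_of)
  have zeroS: "0 \<in> S B" for B unfolding S_def by (rule zero_in_ssums)
  have SU: "S B \<noteq> UNIV" if "B \<subseteq> A" for B
    using incomplete residues_of_mono[OF ssums_mono[OF that], of p] unfolding S_def by auto
  have "\<exists>x. B \<subset> A \<longrightarrow> x \<in> A - B \<and> (\<forall>y\<in>A - B. lam p (S B) y \<le> lam p (S B) x)" for B
  proof (cases "B \<subset> A")
    case True
    have fin': "finite (A - B)" "A - B \<noteq> {}" using fin True by auto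
    obtain x where "x \<in> A - B" "lam p (S B) x = Max (lam p (S B) ` (A - B))"
      using obtains_MAX[OF fin'] by metis
    then have "x \<in> A - B \<and> (\<forall>y\<in>A - B. lam p (S B) y \<le> lam p (S B) x)" using fin' by auto
    then show ?thesis by blast
  qed simp
  then obtain pick where pick: "\<And>B. B \<subset> A \<Longrightarrow> pick B \<in> A - B"
    "\<And>B y. B \<subset> A \<Longrightarrow> y \<in> A - B \<Longrightarrow> lam p (S B) y \<le> lam p (S B) (pick B)"
    by metis
  define B where "B i = ((\<lambda>B. insert (pick B) B) ^^ i) {}" for i
  have B_Suc: "B (Suc i) = insert (pick (B i)) (B i)" for i by (simp add: B_def)
  have B: "B i \<subseteq> A \<and> card (B i) = i" if "i \<le> 100 * L" for i
    using that
  proof (induction i)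
    case (Suc i)
    then have IH: "B i \<subseteq> A" "card (B i) = i" by simp_all
    then have "B i \<subset> A" using A(2) Suc.prems by auto
    then have "pick (B i) \<in> A - B i" by (rule pick(1))
    moreover have "finite (B i)" using IH fin finite_subset by blast
    ultimately show ?case using IH by (simp add: B_Suc)
  qed (simp add: B_def)
  have B_psubset: "B i \<subset> A" if "i < 100 * L" for i
    using B[of i] that A(2) by auto
  have finB: "finite (B i)" if "i \<le> 100 * L" for i using B[OF that] fin finite_subset by blast
  have card_diff: "card (A - B i) = 100 * L - i" if "i \<le> 100 * L" for i
    using B[OF that] A(2) finB[OF that] by (simp add: card_Diff_subset)
  define c where "c i = rcard p (S (B i))" for i
  have c_Suc: "c (Suc i) = c i + lam p (S (B i)) (pick (B i))" if "i < 100 * L" for i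
    unfolding c_def S_def B_Suc
    using finB[of i] pick(1)[OF B_psubset[OF that]] that by (intro rcard_ssums_insert[OF p0]) auto
  have "160000\<^sup>2 \<le> L\<^sup>2" using L(1) by (rule power_mono) simp
  then have p2: "2 < p" using L(3) by simp
  interpret growth "nat p" L c
  proof
    show "395 * nat p \<le> 1000000 * L\<^sup>2" "10000 * L\<^sup>2 \<le> 4 * nat p" "160000 \<le> L" by (fact L)+
  next
    fix i assume i: "i \<le> 100 * L"
    have "c i \<noteq> nat p" using rcard_eq_full[OF p0 perS, of "B i"] SU[of "B i"] B[OF i] unfolding c_def by blast
    then show "c i < nat p" using rcard_le[OF p0, of "S (B i)"] unfolding c_def by simp
  next
    fix i assume i: "i < 100 * L"
    have "pick (B i) \<in> {1..<p}" using pick(1)[OF B_psubset[OF i]] A(1) by auto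
    then have "0 < lam p (S (B i)) (pick (B i))"
      using B[of i] i by (intro lam_pos[OF p perS zeroS SU] not_dvd_residue) auto
    then show "c i < c (Suc i)" by (simp add: c_Suc[OF i])
  next
    fix i h J
    assume i: "i < 100 * L" and h: "1 \<le> h" "2 * h \<le> 100 * L - i" and J: "1 \<le> J" "J * h \<le> c i" "J * h + c i \<le> nat p"
    let ?k = "lam p (S (B i)) (pick (B i))"
    \<comment> \<open>By maximality the remaining elements, together with 0, have \<open>lam\<close>
      at most \<open>?k\<close>; they are the \<open>2 * h + 1\<close> residues that
      \<open>lam_growth\<close> asks for.\<close>
    have "insert 0 (A - B i) \<subseteq> {x. lam p (S (B i)) x \<le> ?k} \<inter> {0..<p}"
      using pick(2)[OF B_psubset[OF i]] A(1) p0 by auto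
    then have "card (insert 0 (A - B i)) \<le> rcard p {x. lam p (S (B i)) x \<le> ?k}"
      unfolding rcard_def by (intro card_mono) auto
    moreover have "card (insert 0 (A - B i)) = Suc (100 * L - i)"
      using card_diff[of i] i A(1) fin by (subst card_insert_disjoint) auto
    ultimately have Y: "2 * h + 1 \<le> rcard p {x. lam p (S (B i)) x \<le> ?k}" using h by simp
    have "J * h \<le> rcard p (- S (B i))" using J(3) rcard_Compl[OF p0, of "S (B i)"] unfolding c_def by linarith
    then have "h * (J - 1) \<le> ?k * J"
      using J(2) unfolding c_def by (intro lam_growth[OF p p2 perS h(1) J(1) _ _ Y])
    then show "h * (J - 1) \<le> (c (Suc i) - c i) * J" by (simp add: c_Suc[OF i])
  qed
  obtain i where i: "5 * L \<le> i" "i < 25 * L" "10 * (c (Suc i) - c i) \<le> 6 * (100 * L - i)"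
    using exists_slow_step by blast
  have i100: "i < 100 * L" using i by linarith
  show ?thesis
  proof (intro exI[of _ "B i"] exI[of _ "lam p (S (B i)) (pick (B i))"] conjI)
    show "B i \<subseteq> A" using B[of i] i100 by simp
    show "75 * L \<le> card (A - B i)" "card (A - B i) \<le> 95 * L" using card_diff[of i] i by simp_all
    show "10 * lam p (S (B i)) (pick (B i)) \<le> 6 * card (A - B i)"
      using card_diff[of i] i i100 c_Suc[OF i100] by simp
    show "\<forall>x\<in>A - B i. lam p (residues_of p (ssums (B i))) x \<le> lam p (S (B i)) (pick (B i))"
      using pick(2)[OF B_psubset[OF i100]] unfolding S_def by blast
    show "nat p \<le> 20 * rcard p (residues_of p (ssums (B i)))"
      "nat p + 20 * rcard p (residues_of p (ssums (B i))) \<le> 20 * nat p"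
      using middle_density[of i] i unfolding c_def S_def by simp_all
  qed
qed

subsection \<open>Dilating the slow elements into a short interval\<close>

text \<open>A representative of least absolute value; \<open>\<bar>cent p x\<bar>\<close> is the
  norm of the residue of \<open>x\<close>, see \<open>Zp_norm_mod\<close>.\<close>

definition cent :: "int \<Rightarrow> int \<Rightarrow> int" where
  "cent p x = (x + p div 2) mod p - p div 2"

lemma cent_cong: "[cent p x = x] (mod p)"
proof -
  have "[(x + p div 2) mod p - p div 2 = (x + p div 2) - p div 2] (mod p)"
    by (intro cong_diff cong_refl) (simp add: cong_def)
  then show ?thesis by (simp add: cent_def)
qed

lemma abs_cent_le:
  assumes "0 < p"
  shows "2 * \<bar>cent p x\<bar> \<le> p"
proof -
  define y where "y = (x + p div 2) mod p"
  define h where "h = p div 2"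
  have "0 \<le> y" "y < p" using assms unfolding y_def by simp_all
  moreover have "2 * h \<le> p" "p \<le> 2 * h + 1" unfolding h_def by linarith+
  moreover have "cent p x = y - h" by (simp add: cent_def y_def h_def)
  ultimately show ?thesis by linarith
qed

lemma cong_small_eq:
  assumes "[a = b] (mod p)" "\<bar>a - b\<bar> < p"
  shows "a = (b::int)"
proof -
  have "p dvd a - b" using assms(1) by (simp add: cong_iff_dvd_diff)
  then show ?thesis using assms(2) dvd_imp_le_int[of "a - b" p] by fastforce
qed

lemma cent_eqI:
  assumes "0 < p" "[x = y] (mod p)" "2 * \<bar>y\<bar> < p"
  shows "cent p x = y"
proof (rule cong_small_eq)
  show "[cent p x = y] (mod p)" by (rule cong_trans[OF cent_cong assms(2)])
  show "\<bar>cent p x - y\<bar> < p" using abs_cent_le[OF assms(1), of x] assms(3) by linarith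
qed

lemma prime_invertible:
  assumes "prime (p::int)" "\<not> p dvd a"
  obtains b where "[a * b = 1] (mod p)"
proof -
  have "coprime a p" using assms by (metis coprime_commute prime_imp_coprime)
  then show ?thesis using that coprime_iff_invertible_int by blast
qed

lemma cong_mult_cancel:
  assumes "[u * a = 1] (mod p)" "[a * x = a * y] (mod (p::int))"
  shows "[x = y] (mod p)"
proof -
  have "[(u * a) * x = (u * a) * y] (mod p)"
    using cong_mult[OF cong_refl[of u] assms(2)] by (simp add: mult.assoc)
  moreover have "[(u * a) * z = z] (mod p)" for z
    using cong_mult[OF assms(1) cong_refl[of z]] by simp
  ultimately show ?thesis by (metis cong_sym cong_trans)
qed

lemma lam_affine:
  assumes p: "0 < p" and S: "periodic p S" and u: "[u * v = 1] (mod p)"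
  shows "lam p {x. u * x \<in> S} x = lam p S (u * x)"
proof -
  have "lam p {x. u * x \<in> S} x = rcard p {s. u * s + 0 \<in> {t \<in> S. t + u * x \<notin> S}}"
    unfolding lam_def by (simp add: distrib_left)
  then show ?thesis
    unfolding lam_def rcard_affine[OF p periodic_lam_set[OF S] u] .
qed

text \<open>Up to sign and full turns, the angle lies between \<open>pi / 50\<close> and
  \<open>pi\<close>, where the cosine decreases.\<close>

lemma one_minus_cos_ge:
  assumes p: "0 < p" and x: "[x = y] (mod p)" and y: "p < 100 * \<bar>y\<bar>" "2 * \<bar>y\<bar> \<le> p"
  shows "1 - cos (pi / 50) \<le> 1 - cos (2 * pi * of_int x / of_int p)"
proof -
  obtain k where "y = x + p * k" using x by (auto simp: cong_iff_lin)
  then have k: "x = y + p * (- k)" by simp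
  have arg: "2 * pi * of_int x / of_int p = 2 * pi * of_int y / of_int p + 2 * pi * of_int (- k)"
    unfolding k using p by (simp add: field_simps)
  have "cos (2 * pi * of_int x / of_int p) = cos (2 * pi * of_int y / of_int p)"
    unfolding arg cos_add cos_int_2pin sin_int_2pin by simp
  also have "\<dots> = cos \<bar>2 * pi * of_int y / of_int p\<bar>" by (rule cos_abs_real[symmetric])
  also have "\<bar>2 * pi * of_int y / of_int p\<bar> = 2 * pi * \<bar>of_int y\<bar> / of_int p"
    using p by (simp add: abs_mult)
  also have "cos (2 * pi * \<bar>of_int y\<bar> / of_int p) \<le> cos (pi / 50)"
  proof (rule cos_monotone_0_pi_le)
    have "real_of_int p \<le> 100 * \<bar>of_int y\<bar>" using y(1) by linarith
    then have "pi * real_of_int p \<le> pi * (100 * \<bar>of_int y\<bar>)" by (rule mult_left_mono) simp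
    then show "pi / 50 \<le> 2 * pi * \<bar>of_int y\<bar> / of_int p" using p by (simp add: field_simps)
    have "2 * \<bar>of_int y\<bar> \<le> real_of_int p" using y(2) by linarith
    then have "pi * (2 * \<bar>of_int y\<bar>) \<le> pi * real_of_int p" by (rule mult_left_mono) simp
    then show "2 * pi * \<bar>of_int y\<bar> / of_int p \<le> pi" using p by (simp add: field_simps)
  qed simp
  finally show ?thesis by simp
qed

text \<open>Any \<open>p\<close> consecutive integers meet every class, and multiplication by
  \<open>u\<close> undoes the dilation.\<close>

lemma covers_if_long:
  fixes \<beta> :: int
  assumes p: "0 < p" and u: "[u * \<beta> = 1] (mod p)" and fin: "finite A"
    and inj: "inj_on (\<lambda>a. cent p (\<beta> * a)) A"
    and I: "{l..h} \<subseteq> ssums ((\<lambda>a. cent p (\<beta> * a)) ` A)" and long: "p \<le> h - l + 1"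
  shows "residues_of p (ssums A) = UNIV"
proof -
  let ?\<psi> = "\<lambda>a. cent p (\<beta> * a)"
  have "z \<in> residues_of p (ssums A)" for z
  proof -
    define w where "w = l + (\<beta> * z - l) mod p"
    have "[w = l + (\<beta> * z - l)] (mod p)" unfolding w_def by (intro cong_add cong_refl) (simp add: cong_def)
    then have w: "[w = \<beta> * z] (mod p)" by simp
    have "0 \<le> (\<beta> * z - l) mod p" "(\<beta> * z - l) mod p < p" using p by simp_all
    then have "w \<in> {l..h}" using long unfolding w_def by simp
    then have "w \<in> ssums (?\<psi> ` A)" by (rule subsetD[OF I])
    then obtain C' where C': "C' \<subseteq> ?\<psi> ` A" "w = \<Sum>C'" unfolding ssums_def by blast
    then obtain C where C: "C \<subseteq> A" "C' = ?\<psi> ` C" by (meson subset_imageE)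
    have "w = (\<Sum>a\<in>C. ?\<psi> a)"
      unfolding C'(2) C(2) by (subst sum.reindex[OF inj_on_subset[OF inj C(1)]]) simp
    moreover have "[(\<Sum>a\<in>C. ?\<psi> a) = (\<Sum>a\<in>C. \<beta> * a)] (mod p)" by (intro cong_sum cent_cong)
    ultimately have "[\<beta> * z = \<beta> * \<Sum>C] (mod p)"
      using w by (simp add: sum_distrib_left) (metis cong_sym cong_trans)
    then have "[z = \<Sum>C] (mod p)" by (rule cong_mult_cancel[OF u])
    moreover have "\<Sum>C \<in> ssums A" using C(1) unfolding ssums_def by blast
    ultimately show ?thesis by (intro residues_ofI)
  qed
  then show ?thesis by blast
qed

lemma inj_on_cent_mult:
  assumes p: "0 < p" and u: "[u * r = 1] (mod p)" and R: "R \<subseteq> {1..<p}"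
  shows "inj_on (\<lambda>x. cent p (r * x)) R"
proof (rule inj_onI)
  fix a b assume ab: "a \<in> R" "b \<in> R" "cent p (r * a) = cent p (r * b)"
  then have "[r * a = r * b] (mod p)" using cent_cong[of p "r * a"] cent_cong[of p "r * b"]
    by (metis cong_sym cong_trans)
  then have "[a = b] (mod p)" by (rule cong_mult_cancel[OF u])
  then show "a = b" by (rule cong_small_eq) (use subsetD[OF R ab(1)] subsetD[OF R ab(2)] in auto)
qed

lemma norm_sum_bound:
  fixes \<beta> :: int
  assumes p: "0 < p" "p \<le> 2532 * (int L)\<^sup>2" and \<beta>: "[u * \<beta> = 1] (mod p)"
    and A: "A \<subseteq> {1..<p}" and R: "R \<subseteq> A" "\<And>x. x \<in> R \<Longrightarrow> \<bar>cent p (\<beta> * x)\<bar> \<le> M"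
    and M: "0 \<le> M" "77 * M \<le> 49 * int \<rho>" and \<rho>: "75 * L \<le> \<rho>" "\<rho> \<le> 95 * L" "\<rho> \<le> card R + E"
    and L: "100 * E + 100 \<le> L"
    and incomplete: "\<And>a. a \<in> A \<Longrightarrow> residues_of p (ssums (A - {a})) \<noteq> UNIV"
  shows "(\<Sum>a\<in>A. \<bar>cent p (\<beta> * a)\<bar>) \<le> p + 13 * M + 12"
proof -
  let ?\<psi> = "\<lambda>a. cent p (\<beta> * a)"
  have finA: "finite A" by (rule finite_subset[OF A]) simp
  have finR: "finite R" by (rule finite_subset[OF R(1) finA])
  have inj: "inj_on ?\<psi> A" by (rule inj_on_cent_mult[OF p(1) \<beta> A])
  have nz: "?\<psi> a \<noteq> 0" if "a \<in> A" for a
  proof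
    assume "?\<psi> a = 0"
    then have "[\<beta> * a = \<beta> * 0] (mod p)" using cent_cong[of p "\<beta> * a"] by (simp add: cong_sym_eq)
    then have "[a = 0] (mod p)" by (rule cong_mult_cancel[OF \<beta>])
    then have "a = 0" by (rule cong_small_eq) (use subsetD[OF A that] in auto)
    then show False using subsetD[OF A that] by simp
  qed
  have "E < L" "L \<le> \<rho>" using \<rho>(1) L by simp_all
  then have "1 \<le> card R" using \<rho>(3) by simp
  \<comment> \<open>One element is set aside because incompleteness is assumed only after removing
    an element; choosing it in \<open>R\<close> adds at most \<open>M\<close> to the final
    bound.\<close>
  then obtain a0 where a0: "a0 \<in> R" by (metis card.empty ex_in_conv not_one_le_zero)
  then have a0A: "a0 \<in> A" using R(1) by blast
  define \<Psi> where "\<Psi> = ?\<psi> ` (A - {a0})"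
  define Q where "Q = ?\<psi> ` (R - {a0})"
  have injA: "inj_on ?\<psi> (A - {a0})" by (rule inj_on_subset[OF inj]) blast
  have injR: "inj_on ?\<psi> (R - {a0})" by (rule inj_on_subset[OF inj]) (use R(1) in blast)
  have Q\<Psi>: "Q \<subseteq> \<Psi>" unfolding Q_def \<Psi>_def using R(1) by blast
  have fin\<Psi>: "finite \<Psi>" unfolding \<Psi>_def using finA by simp
  have finQ: "finite Q" by (rule finite_subset[OF Q\<Psi> fin\<Psi>])
  have cardQ: "card Q + 1 = card R" unfolding Q_def card_image[OF injR] using a0 finR \<open>1 \<le> card R\<close> by simp
  have QM: "Q \<subseteq> {-M..M}"
  proof
    fix q assume "q \<in> Q"
    then have "\<bar>q\<bar> \<le> M" unfolding Q_def using R(2) by blast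
    then show "q \<in> {-M..M}" by auto
  qed
  have Q0: "0 \<notin> Q" unfolding Q_def using nz R(1) by force
  define N where "N = {q \<in> Q. q < 0}"
  define P where "P = {q \<in> Q. 0 < q}"
  have "q \<in> N \<or> q \<in> P" if "q \<in> Q" for q using that Q0 by (cases q "0::int" rule: linorder_cases) (auto simp: P_def N_def)
  then have NP: "Q = N \<union> P" "N \<inter> P = {}" "finite N" "finite P" using finQ by (auto simp: P_def N_def)
  have cNP: "card Q = card N + card P" using card_Un_disjoint[OF NP(3,4,2)] unfolding NP(1)[symmetric] .
  have "card N \<le> card {-M..-1}" by (rule card_mono) (use QM in \<open>auto simp: N_def\<close>)
  then have cN: "int (card N) \<le> M" using M(1) by simp
  have "card P \<le> card {1..M}" by (rule card_mono) (use QM in \<open>auto simp: P_def\<close>)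
  then have cP: "int (card P) \<le> M" using M(1) by simp
  define s where "s = (M + 12) div 13"
  have s: "0 \<le> s" "M \<le> 13 * s" "13 * s \<le> M + 12" using M(1) unfolding s_def by linarith+
  have cQ: "int \<rho> \<le> int (card N) + int (card P) + 1 + int E" using \<rho>(3) cardQ cNP by linarith
  have L': "100 * int E + 100 \<le> int L" "75 * int L \<le> int \<rho>" "int \<rho> \<le> 95 * int L" using L \<rho>(1,2) by linarith+
  \<comment> \<open>Each sign occurs at most \<open>M\<close> times, so the other occurs at least
    \<open>card Q - M\<close> times. Apart from lower-order terms the claim is
    \<open>40 / 13 * M \<le> 2 * \<rho>\<close>; as \<open>40 / 13 * 49 / 77 < 2\<close>, a multiple
    of \<open>L\<close> is left to pay for \<open>E\<close> and the constants.\<close>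
  have "M + s + 30 \<le> 2 * int (card N)" using cQ cP s M L' by linarith
  moreover have "M + s + 30 \<le> 2 * int (card P)" using cQ cN s M L' by linarith
  ultimately have I: "{6 * M + 6 + (\<Sum>q\<in>Q. min q 0)..(\<Sum>q\<in>Q. max q 0) - 6 * M - 6} \<subseteq> ssums Q"
    unfolding N_def P_def by (rule two_sided_interval[OF M(1) QM Q0 s(1,2)])
  define l where "l = 6 * M + 6 + (\<Sum>q\<in>Q. min q 0)"
  define h where "h = (\<Sum>q\<in>Q. max q 0) - 6 * M - 6"
  have absd: "(\<Sum>q\<in>X. max q 0) - (\<Sum>q\<in>X. min q 0) = (\<Sum>q\<in>X. \<bar>q\<bar>)" for X :: "int set"
    unfolding sum_subtractf[symmetric] by (intro sum.cong refl) auto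
  have "74 * int L \<le> int (card Q)" using cQ cNP L' by simp
  then have "(74 * int L)\<^sup>2 \<le> (int (card Q))\<^sup>2" by (rule power_mono) simp
  then have big: "1369 * (int L)\<^sup>2 \<le> (\<Sum>q\<in>Q. \<bar>q\<bar>)"
    using sum_abs_ints_ge[OF finQ Q0] by (simp add: power_mult_distrib)
  have "100 * int L \<le> (int L)\<^sup>2" unfolding power2_eq_square using L' by (intro mult_right_mono) auto
  \<comment> \<open>Here \<open>1369 = 74^2 / 4\<close>. As \<open>2 * 1369 = 2738\<close> exceeds
    \<open>2532\<close>, the margin of order \<open>L^2\<close> covers the loss
    \<open>24 * M + 22\<close>. An interval of at least \<open>p / 2\<close> integers can be
    extended by any centered representative.\<close>
  then have half: "p \<le> 2 * (h - l + 1)"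
  proof -
    define X where "X = (int L)\<^sup>2"
    define T where "T = (\<Sum>q\<in>Q. \<bar>q\<bar>)"
    have "77 * M \<le> 4655 * int L" using M(2) L'(3) by linarith
    then have "M \<le> 61 * int L" using L'(1) by linarith
    moreover have "100 * int L \<le> X" unfolding X_def by fact
    ultimately have "24 * M + 22 \<le> 16 * X" using L'(1) by linarith
    moreover have "1369 * X \<le> T" "p \<le> 2532 * X" using big p(2) unfolding X_def T_def .
    moreover have "h - l = T - 12 * M - 12" using absd[of Q] unfolding h_def l_def T_def by simp
    moreover have "0 \<le> X" unfolding X_def by simp
    ultimately show ?thesis by simp
  qed
  have "{l + (\<Sum>x\<in>\<Psi> - Q. min x 0)..h + (\<Sum>x\<in>\<Psi> - Q. max x 0)} \<subseteq> ssums (Q \<union> (\<Psi> - Q))"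
  proof (rule ssums_interval_extend[OF finQ])
    show "{l..h} \<subseteq> ssums Q" using I unfolding l_def h_def .
    show "\<bar>x\<bar> \<le> h - l + 1" if x: "x \<in> \<Psi> - Q" for x
    proof -
      obtain a where "x = ?\<psi> a" using x unfolding \<Psi>_def by blast
      then show ?thesis using abs_cent_le[OF p(1), of "\<beta> * a"] half by simp
    qed
  qed (use fin\<Psi> in auto)
  moreover have "Q \<union> (\<Psi> - Q) = ?\<psi> ` (A - {a0})" using Q\<Psi> unfolding \<Psi>_def by blast
  ultimately have I': "{l + (\<Sum>x\<in>\<Psi> - Q. min x 0)..h + (\<Sum>x\<in>\<Psi> - Q. max x 0)} \<subseteq> ssums (?\<psi> ` (A - {a0}))"
    by (simp only:)
  \<comment> \<open>The extended interval has \<open>12 * M + 11\<close> integers fewer than the sum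
    of absolute values over \<open>\<Psi>\<close>, and incompleteness keeps it shorter than
    \<open>p\<close>.\<close>
  have "\<not> p \<le> (h + (\<Sum>x\<in>\<Psi> - Q. max x 0)) - (l + (\<Sum>x\<in>\<Psi> - Q. min x 0)) + 1"
    using covers_if_long[OF p(1) \<beta> _ injA I'] incomplete[OF a0A] finA by blast
  moreover have "(\<Sum>x\<in>\<Psi>. \<bar>x\<bar>) = (\<Sum>x\<in>\<Psi> - Q. \<bar>x\<bar>) + (\<Sum>x\<in>Q. \<bar>x\<bar>)" by (rule sum.subset_diff[OF Q\<Psi> fin\<Psi>])
  ultimately have "(\<Sum>x\<in>\<Psi>. \<bar>x\<bar>) \<le> p + 12 * M + 12"
    using absd[of Q] absd[of "\<Psi> - Q"] unfolding l_def h_def by linarith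
  moreover have "(\<Sum>x\<in>\<Psi>. \<bar>x\<bar>) = (\<Sum>a\<in>A - {a0}. \<bar>?\<psi> a\<bar>)"
    unfolding \<Psi>_def by (subst sum.reindex[OF injA]) simp
  moreover have "(\<Sum>a\<in>A. \<bar>?\<psi> a\<bar>) = \<bar>?\<psi> a0\<bar> + (\<Sum>a\<in>A - {a0}. \<bar>?\<psi> a\<bar>)" by (rule sum.remove[OF finA a0A])
  moreover have "\<bar>?\<psi> a0\<bar> \<le> M" by (rule R(2)[OF a0])
  ultimately show ?thesis by linarith
qed

text \<open>Each element outside the short interval adds at least
  \<open>\<kappa> = 1 - cos (pi / 50)\<close> to the sum in \<open>exists_frequency\<close>. As
  \<open>m * (p - m) \<ge> p^2 / 400\<close>, the number of such elements times
  \<open>\<kappa>\<close> is at most \<open>240 * \<rho>^2 / p\<close>, hence at most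
  \<open>240 * 9025 / 2500 < 867\<close>.\<close>

lemma card_small_angle:
  assumes p: "prime p" and S: "periodic p S" and R: "R \<subseteq> {1..<p}" "card R = \<rho>" "\<And>x. x \<in> R \<Longrightarrow> lam p S x \<le> k"
    and m: "nat p \<le> 20 * rcard p S" "nat p + 20 * rcard p S \<le> 20 * nat p"
    and k: "10 * k \<le> 6 * \<rho>" and \<rho>: "\<rho> \<le> 95 * L" "10000 * L\<^sup>2 \<le> 4 * nat p"
    and E: "867 \<le> real E * (1 - cos (pi / 50))"
  shows "\<exists>r\<in>{1..<p}. \<rho> \<le> card {x \<in> R. 100 * \<bar>cent p (r * x)\<bar> \<le> p} + E"
proof -
  have p0: "0 < p" by (rule prime_gt_0_int[OF p])
  have finR: "finite R" by (rule finite_subset[OF R(1)]) simp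
  define m where "m = rcard p S"
  have m0: "0 < m" "m < nat p" using m p0 unfolding m_def by linarith+
  obtain r where r: "r \<in> {1..<p}" and bound: "real m * (of_int p - real m)
      * (\<Sum>x\<in>R. 1 - cos (2 * pi * of_int r * of_int x / of_int p)) \<le> of_int p * real (card R) * real k"
    using exists_frequency[OF p0 S _ _ finR R(3)] m0 unfolding m_def by blast
  define \<kappa> where "\<kappa> = 1 - cos (pi / 50)"
  define bad where "bad = {x \<in> R. \<not> 100 * \<bar>cent p (r * x)\<bar> \<le> p}"
  have "cos (pi / 50) < cos 0" by (rule cos_monotone_0_pi) (use pi_gt_zero in auto)
  then have \<kappa>: "0 < \<kappa>" unfolding \<kappa>_def by simp
  have "real (card bad) * \<kappa> = (\<Sum>x\<in>bad. \<kappa>)" by simp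
  also have "\<dots> \<le> (\<Sum>x\<in>bad. 1 - cos (2 * pi * of_int (r * x) / of_int p))"
    unfolding \<kappa>_def by (intro sum_mono one_minus_cos_ge[OF p0 cong_sym[OF cent_cong]] abs_cent_le[OF p0]) (auto simp: bad_def)
  also have "\<dots> \<le> (\<Sum>x\<in>R. 1 - cos (2 * pi * of_int (r * x) / of_int p))"
    by (rule sum_mono2) (use finR in \<open>auto simp: bad_def\<close>)
  also have "\<dots> = (\<Sum>x\<in>R. 1 - cos (2 * pi * of_int r * of_int x / of_int p))"
    by (simp add: mult.assoc)
  finally have le: "real (card bad) * \<kappa> \<le> (\<Sum>x\<in>R. 1 - cos (2 * pi * of_int r * of_int x / of_int p))" .
  define q where "q = real_of_int p"
  have q0: "0 < q" using p0 by (simp add: q_def)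
  have qn: "q = real (nat p)" using p0 by (simp add: q_def)
  have "q \<le> 20 * real m" using m(1) unfolding qn m_def by linarith
  moreover have "q \<le> 20 * (q - real m)"
  proof -
    have "real (nat p + 20 * m) \<le> real (20 * nat p)" using m(2) unfolding m_def by (rule of_nat_mono)
    then show ?thesis by (simp add: qn)
  qed
  ultimately have "q * q \<le> (20 * real m) * (20 * (q - real m))" using q0 by (intro mult_mono) auto
  then have mm: "q * q \<le> 400 * (real m * (q - real m))" by (simp add: algebra_simps)
  have "q * q * (real (card bad) * \<kappa>) \<le> 400 * (real m * (q - real m)) * (real (card bad) * \<kappa>)"
    using \<kappa> by (intro mult_right_mono[OF mm]) simp
  also have "\<dots> \<le> 400 * (real m * (q - real m)) * (\<Sum>x\<in>R. 1 - cos (2 * pi * of_int r * of_int x / of_int p))"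
  proof (rule mult_left_mono[OF le])
    have "0 \<le> q * q" by simp
    then show "0 \<le> 400 * (real m * (q - real m))" using mm by linarith
  qed
  also have "\<dots> \<le> 400 * (q * real \<rho> * real k)" using bound unfolding R(2) q_def by simp
  also have "\<dots> \<le> 400 * (q * real \<rho> * (3 / 5 * real \<rho>))"
    using k q0 by (intro mult_left_mono) auto
  also have "\<dots> = 240 * q * (real \<rho>)\<^sup>2" by (simp add: power2_eq_square)
  also have "\<dots> \<le> 240 * q * (9025 * (real L)\<^sup>2)"
  proof -
    have "(real \<rho>)\<^sup>2 \<le> (95 * real L)\<^sup>2" using \<rho>(1) by (intro power_mono) linarith+
    then show ?thesis using q0 by (intro mult_left_mono) (auto simp: power_mult_distrib)
  qed
  also have "\<dots> \<le> q * (867 * q)"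
  proof -
    have "real (10000 * L\<^sup>2) \<le> real (4 * nat p)" using \<rho>(2) by (rule of_nat_mono)
    then have "2500 * (real L)\<^sup>2 \<le> q" by (simp add: qn)
    then have "240 * (9025 * (real L)\<^sup>2) \<le> 867 * q" using q0 by simp
    then have "q * (240 * (9025 * (real L)\<^sup>2)) \<le> q * (867 * q)" using q0 by (intro mult_left_mono) auto
    then show ?thesis by (simp add: ac_simps)
  qed
  finally have "(q * q) * (real (card bad) * \<kappa>) \<le> (q * q) * 867" by (simp add: ac_simps)
  then have "real (card bad) * \<kappa> \<le> 867" using q0 by (subst (asm) mult_le_cancel_left_pos) auto
  also have "\<dots> \<le> real E * \<kappa>" using E unfolding \<kappa>_def .
  finally have "card bad \<le> E" using \<kappa> by simp
  moreover have "R = bad \<union> {x \<in> R. 100 * \<bar>cent p (r * x)\<bar> \<le> p}" "bad \<inter> {x \<in> R. 100 * \<bar>cent p (r * x)\<bar> \<le> p} = {}"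
    unfolding bad_def by auto
  then have "card R = card bad + card {x \<in> R. 100 * \<bar>cent p (r * x)\<bar> \<le> p}"
    using finR by (metis (no_types, lifting) card_Un_disjoint finite_Un)
  ultimately show ?thesis using r R(2) by (intro bexI[of _ r]) auto
qed

text \<open>The 40-fold sums have size at most \<open>2 * p / 5\<close>, so distinct ones stay
  distinct modulo \<open>p\<close>, and their \<open>lam\<close> is at most
  \<open>40 * k \<le> 24 * \<rho>\<close>. More than \<open>49 * \<rho>\<close> such residues would
  contradict \<open>lam_growth\<close> with \<open>J = 1000\<close>, because
  \<open>999 * 24.5 > 24000\<close>.\<close>

lemma nfold_card_bound:
  assumes p: "prime p" "2 < p" and S: "periodic p S" and Y: "\<And>y. y \<in> Y \<Longrightarrow> lam p S y \<le> k" "\<And>y. y \<in> Y \<Longrightarrow> 100 * \<bar>y\<bar> \<le> p"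
    and m: "nat p \<le> 20 * rcard p S" "nat p + 20 * rcard p S \<le> 20 * nat p"
    and k: "10 * k \<le> 6 * \<rho>" and \<rho>: "75 * L \<le> \<rho>" "\<rho> \<le> 95 * L" "10000 * L\<^sup>2 \<le> 4 * nat p" "160000 \<le> L"
  shows "card (nfold 40 Y) \<le> 49 * \<rho>"
proof -
  let ?X = "{x. lam p S x \<le> 24 * \<rho>}"
  have p0: "0 < p" using p(2) by simp
  have lam: "w \<in> ?X" if "w \<in> nfold 40 Y" for w
  proof -
    have "lam p S w \<le> 40 * k" by (rule nfold_lam_le[OF p0 S Y(1) that])
    then show ?thesis using k by simp
  qed
  have small: "5 * \<bar>w\<bar> \<le> 2 * p" if "w \<in> nfold 40 Y" for w
  proof -
    have "\<bar>y\<bar> \<le> p div 100" if "y \<in> Y" for y using Y(2)[OF that] by linarith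
    then have "\<bar>w\<bar> \<le> int 40 * (p div 100)" by (rule nfold_abs_le[OF _ that])
    moreover have "100 * (p div 100) \<le> p" by simp
    ultimately show ?thesis by simp
  qed
  have "inj_on (\<lambda>w. w mod p) (nfold 40 Y)"
  proof (rule inj_onI)
    fix v w assume vw: "v \<in> nfold 40 Y" "w \<in> nfold 40 Y" "v mod p = w mod p"
    then have "[v = w] (mod p)" by (simp add: cong_def)
    moreover have "\<bar>v - w\<bar> < p" using small[OF vw(1)] small[OF vw(2)] p0 by linarith
    ultimately show "v = w" by (rule cong_small_eq)
  qed
  then have "card (nfold 40 Y) = card ((\<lambda>w. w mod p) ` nfold 40 Y)" by (rule card_image[symmetric])
  also have "\<dots> \<le> rcard p ?X"
    unfolding rcard_def
  proof (rule card_mono)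
    show "(\<lambda>w. w mod p) ` nfold 40 Y \<subseteq> ?X \<inter> {0..<p}"
    proof
      fix x assume "x \<in> (\<lambda>w. w mod p) ` nfold 40 Y"
      then obtain w where w: "w \<in> nfold 40 Y" "x = w mod p" by blast
      have "x \<in> ?X" unfolding w(2) using lam[OF w(1)] by (subst periodic_mod[OF periodic_level[OF S]])
      then show "x \<in> ?X \<inter> {0..<p}" using w(2) p0 by simp
    qed
  qed simp
  also have "\<dots> \<le> 49 * \<rho>"
  proof (rule ccontr)
    assume neg: "\<not> rcard p ?X \<le> 49 * \<rho>"
    define h where "h = (49 * \<rho>) div 2"
    have h: "2 * h \<le> 49 * \<rho>" "49 * \<rho> \<le> 2 * h + 1" unfolding h_def by linarith+
    have Y: "2 * h + 1 \<le> rcard p ?X" using neg h by linarith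
    have "160000 * L \<le> L\<^sup>2" unfolding power2_eq_square by (rule mult_le_mono1[OF \<rho>(4)])
    then have "400000000 * L \<le> nat p" using \<rho>(3) by linarith
    then have Jh: "20 * (1000 * h) \<le> nat p" using h(1) \<rho>(2) by linarith
    have m': "1000 * h \<le> rcard p S" "1000 * h \<le> rcard p (- S)"
      using Jh m rcard_Compl[OF p0, of S] by linarith+
    have "h * (1000 - 1) \<le> 24 * \<rho> * 1000"
      by (rule lam_growth[OF p S _ _ m' Y]) (use h \<rho> in linarith)+
    then have "999 * h \<le> 24000 * \<rho>" by simp
    then show False using h \<rho> by linarith
  qed
  finally show ?thesis .
qed

lemma exists_dilation:
  assumes p: "prime p" and A: "A \<subseteq> {1..<p}" "card A = 100 * L"
    and L: "160000 \<le> L" "395 * nat p \<le> 1000000 * L\<^sup>2" "10000 * L\<^sup>2 \<le> 4 * nat p"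
    and E: "867 \<le> real E * (1 - cos (pi / 50))" "100 * E + 100 \<le> L"
    and incomplete: "residues_of p (ssums A) \<noteq> UNIV"
  shows "\<exists>\<beta>\<in>{1..<p}. \<exists>R M \<rho>. R \<subseteq> A \<and> (\<forall>x\<in>R. \<bar>cent p (\<beta> * x)\<bar> \<le> M) \<and> 0 \<le> M \<and> 77 * M \<le> 49 * int \<rho>
    \<and> 75 * L \<le> \<rho> \<and> \<rho> \<le> 95 * L \<and> \<rho> \<le> card R + E"
proof -
  have p0: "0 < p" by (rule prime_gt_0_int[OF p])
  have "160000\<^sup>2 \<le> L\<^sup>2" using L(1) by (rule power_mono) simp
  then have p2: "2 < p" using L(3) by simp
  obtain B k where B: "B \<subseteq> A" "75 * L \<le> card (A - B)" "card (A - B) \<le> 95 * L" "10 * k \<le> 6 * card (A - B)"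
    "\<forall>x\<in>A - B. lam p (residues_of p (ssums B)) x \<le> k"
    "nat p \<le> 20 * rcard p (residues_of p (ssums B))"
    "nat p + 20 * rcard p (residues_of p (ssums B)) \<le> 20 * nat p"
    using exists_slow_subset[OF p A L incomplete] by blast
  define S where "S = residues_of p (ssums B)"
  define \<rho> where "\<rho> = card (A - B)"
  have perS: "periodic p S" unfolding S_def by (rule periodic_residues_of)
  have \<rho>: "75 * L \<le> \<rho>" "\<rho> \<le> 95 * L" "10 * k \<le> 6 * \<rho>" using B(2-4) unfolding \<rho>_def .
  have mS: "nat p \<le> 20 * rcard p S" "nat p + 20 * rcard p S \<le> 20 * nat p" using B(6,7) unfolding S_def .
  have lamR: "lam p S x \<le> k" if "x \<in> A - B" for x using B(5) that unfolding S_def by blast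
  have AB: "A - B \<subseteq> {1..<p}" using A(1) by blast
  obtain r where r: "r \<in> {1..<p}" and R: "\<rho> \<le> card {x \<in> A - B. 100 * \<bar>cent p (r * x)\<bar> \<le> p} + E"
    using card_small_angle[OF p perS AB \<rho>_def[symmetric] lamR mS \<rho>(3,2) L(3) E(1)] by blast
  define R where "R = {x \<in> A - B. 100 * \<bar>cent p (r * x)\<bar> \<le> p}"
  have RA: "R \<subseteq> A - B" unfolding R_def by blast
  have cR: "\<rho> \<le> card R + E" using R unfolding R_def .
  have finR: "finite R" using RA AB finite_subset[of R "{1..<p}"] by blast
  obtain u where u: "[r * u = 1] (mod p)" by (rule prime_invertible[OF p not_dvd_residue[OF r]])
  have u': "[u * r = 1] (mod p)" using u by (simp add: mult.commute)
  define \<psi> where "\<psi> x = cent p (r * x)" for x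
  have inj: "inj_on \<psi> R" unfolding \<psi>_def using RA AB by (intro inj_on_cent_mult[OF p0 u']) blast
  have nz: "\<psi> x \<noteq> 0" if x: "x \<in> R" for x
  proof
    assume "\<psi> x = 0"
    then have "[r * x = r * 0] (mod p)" using cent_cong[of p "r * x"] by (simp add: \<psi>_def cong_sym_eq)
    then have "[x = 0] (mod p)" by (rule cong_mult_cancel[OF u'])
    moreover have "x \<in> {1..<p}" using x RA AB by blast
    ultimately show False using not_dvd_residue by (simp add: cong_0_iff)
  qed
  \<comment> \<open>The dilate of \<open>S\<close> by \<open>r\<close>, for which
    \<open>\<psi> x\<close> has the same \<open>lam\<close> as \<open>x\<close> has for
    \<open>S\<close>.\<close>
  define S' where "S' = {x. u * x \<in> S}"
  have perS': "periodic p S'" unfolding S'_def using periodic_affine[OF perS, of u 0] by simp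
  have rS': "rcard p S' = rcard p S" unfolding S'_def using rcard_affine[OF p0 perS u', of 0] by simp
  have lamS': "lam p S' (\<psi> x) \<le> k" if x: "x \<in> R" for x
  proof -
    have 1: "[u * \<psi> x = u * (r * x)] (mod p)" unfolding \<psi>_def by (intro cong_mult cong_refl cent_cong)
    have 2: "[u * (r * x) = x] (mod p)" using cong_mult[OF u' cong_refl[of x]] by (simp add: mult.assoc)
    have "lam p S (u * \<psi> x) = lam p S x" by (rule lam_cong[OF perS cong_trans[OF 1 2]])
    then have "lam p S' (\<psi> x) = lam p S x" unfolding S'_def by (simp add: lam_affine[OF p0 perS u'])
    then show ?thesis using lamR[of x] x RA by auto
  qed
  define Y where "Y = insert 0 (\<psi> ` R \<union> uminus ` \<psi> ` R)"
  have finY: "finite Y" unfolding Y_def using finR by simp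
  have lamY: "lam p S' y \<le> k" if y: "y \<in> Y" for y
    using y lamS' unfolding Y_def by (auto simp: lam_uminus[OF p0 perS'])
  have smallY: "100 * \<bar>y\<bar> \<le> p" if y: "y \<in> Y" for y
    using y p0 unfolding Y_def \<psi>_def R_def by auto
  have nf: "card (nfold 40 Y) \<le> 49 * \<rho>"
    by (rule nfold_card_bound[OF p p2 perS' lamY smallY _ _ \<rho>(3,1,2) L(3,1)]) (use mS rS' in simp_all)
  have cardY: "card R + 1 \<le> card Y"
  proof -
    have "card (insert 0 (\<psi> ` R)) \<le> card Y" unfolding Y_def by (rule card_mono) (use finR in auto)
    moreover have "0 \<notin> \<psi> ` R" using nz by force
    then have "card (insert 0 (\<psi> ` R)) = card R + 1" using card_image[OF inj] finR by simp
    ultimately show ?thesis by simp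
  qed
  have symY: "- y \<in> Y" if "y \<in> Y" for y using that unfolding Y_def by auto
  define M0 where "M0 = Max Y"
  have YM: "Y \<subseteq> {-M0..M0}"
  proof
    fix y assume y: "y \<in> Y"
    then have "y \<le> M0" "- y \<le> M0" unfolding M0_def using finY symY by (auto intro: Max_ge)
    then show "y \<in> {-M0..M0}" by simp
  qed
  have M0Y: "M0 \<in> Y" unfolding M0_def by (rule Max_in[OF finY]) (auto simp: Y_def)
  have EL: "E < L" using E(2) by simp
  then have R1: "1 \<le> card R" using cR \<rho>(1) by linarith
  then obtain x0 where x0: "x0 \<in> R" by (metis card.empty ex_in_conv not_one_le_zero)
  have "\<psi> x0 \<in> Y" using x0 unfolding Y_def by blast
  then have M0: "0 < M0" using YM nz[OF x0] by fastforce
  \<comment> \<open>With 40 summands the threshold \<open>2 * n - 7\<close> is 73, which beats 49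
    despite the \<open>E\<close> lost elements; \<open>2 * n - 3 = 77\<close> then yields the ratio
    \<open>49 / 77\<close>.\<close>
  have "49 * \<rho> < 73 * (card Y - 1)" using cardY cR \<rho>(1) EL by linarith
  then have "card (nfold 40 Y) < (2 * 40 - 7) * (card Y - 1)" using nf by simp
  then obtain d M where d: "0 < d" "M0 = d * M" "\<forall>y\<in>Y. d dvd y" "(2 * 40 - 3) * nat M \<le> card (nfold 40 Y)"
    using nfold_structure[OF finY _ M0Y YM symY M0, of 40] by (auto simp: Y_def)
  have M: "0 < M" using d(1,2) M0 by (simp add: zero_less_mult_iff)
  have "77 * nat M \<le> 49 * \<rho>" using d(4) nf by simp
  then have M77: "77 * M \<le> 49 * int \<rho>" using M by linarith
  have "d \<le> M0" unfolding d(2) using M d(1) by simp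
  moreover have "100 * M0 \<le> p" using smallY[OF M0Y] M0 by simp
  ultimately have dp: "d \<in> {1..<p}" using d(1) M0 by simp
  obtain e where e: "[d * e = 1] (mod p)" by (rule prime_invertible[OF p not_dvd_residue[OF dp]])
  \<comment> \<open>This is \<open>r / d\<close> modulo \<open>p\<close>: it turns each integer
    \<open>\<psi> x\<close> into its quotient by \<open>d\<close>.\<close>
  define \<beta> where "\<beta> = (e * r) mod p"
  have inv: "[(u * d) * (e * r) = 1] (mod p)"
    using cong_mult[OF u' e] by (simp add: ac_simps)
  have "\<beta> \<noteq> 0"
  proof
    assume "\<beta> = 0"
    then have "p dvd e * r" unfolding \<beta>_def by (rule dvd_eq_mod_eq_0[THEN iffD2])
    then have "[(u * d) * (e * r) = 0] (mod p)" by (simp add: cong_0_iff)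
    then have "[1 = 0] (mod p)" using inv by (meson cong_sym cong_trans)
    then show False using p2 by (simp add: cong_def)
  qed
  then have \<beta>: "\<beta> \<in> {1..<p}" using p0 pos_mod_sign[OF p0, of "e * r"] pos_mod_bound[OF p0, of "e * r"]
    unfolding \<beta>_def by simp
  have "\<bar>cent p (\<beta> * x)\<bar> \<le> M" if x: "x \<in> R" for x
  proof -
    have \<psi>Y: "\<psi> x \<in> Y" using x unfolding Y_def by blast
    then obtain q where q: "\<psi> x = d * q" using d(3) by (meson dvdE)
    have "\<bar>d * q\<bar> \<le> d * M" using subsetD[OF YM \<psi>Y] q d(2) by auto
    then have "d * \<bar>q\<bar> \<le> d * M" using d(1) by (simp add: abs_mult)
    then have qM: "\<bar>q\<bar> \<le> M" using d(1) by simp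
    have "M \<le> M0" unfolding d(2) using d(1) M by simp
    then have q2: "2 * \<bar>q\<bar> < p" using qM \<open>100 * M0 \<le> p\<close> M0 by linarith
    have "[\<beta> * x = (e * r) * x] (mod p)" unfolding \<beta>_def by (intro cong_mult cong_refl) (simp add: cong_def)
    then have 1: "[\<beta> * x = e * (r * x)] (mod p)" by (simp add: mult.assoc)
    have 2: "[e * (r * x) = e * (d * q)] (mod p)" unfolding q[symmetric] \<psi>_def by (intro cong_mult cong_refl cong_sym[OF cent_cong])
    have 3: "[e * (d * q) = q] (mod p)" using cong_mult[OF e cong_refl[of q]] by (simp add: ac_simps)
    have "[\<beta> * x = q] (mod p)" by (rule cong_trans[OF 1 cong_trans[OF 2 3]])
    then have "cent p (\<beta> * x) = q" by (rule cent_eqI[OF p0 _ q2])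
    then show ?thesis using qM by simp
  qed
  moreover have "R \<subseteq> A" using RA by blast
  ultimately show ?thesis using \<beta> M M77 \<rho>(1,2) cR
    by (intro bexI[of _ \<beta>] exI[of _ R] exI[of _ M] exI[of _ \<rho>]) auto
qed

subsection \<open>The bound on the sum of norms\<close>

lemma finsum_Zp:
  assumes p: "1 < p" and B: "finite B" "B \<subseteq> carrier (Zp p)"
  shows "finsum (Zp p) (\<lambda>x. x) B = \<Sum>B mod int p"
proof -
  interpret residues "int p" "Zp p" using p by unfold_locales simp_all
  show ?thesis
    using B
  proof (induction B rule: finite_induct)
    case empty
    then show ?case by (simp add: res_zero_eq)
  next
    case (insert x B)
    then have "finsum (Zp p) (\<lambda>x. x) (insert x B) = x \<oplus>\<^bsub>Zp p\<^esub> finsum (Zp p) (\<lambda>x. x) B"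
      by (intro finsum_insert) auto
    then show ?case using insert by (simp add: res_add_eq mod_simps)
  qed
qed

lemma carrier_Zp: "carrier (Zp p) = {0..<int p}"
  by (auto simp: residue_ring_def)

text \<open>If every \<open>z - a\<close> were a possibly empty sum over the other elements,
  adjoining \<open>a\<close> would exhibit every \<open>z\<close> as a nonempty subset sum.\<close>

lemma incomplete_remove:
  assumes p: "1 < p" and A: "A \<subseteq> carrier (Zp p)" "incomplete p A" and a: "a \<in> A"
  shows "residues_of (int p) (ssums (A - {a})) \<noteq> UNIV"
proof
  assume full: "residues_of (int p) (ssums (A - {a})) = UNIV"
  have fin: "finite A" using A(1) finite_subset by (auto simp: carrier_Zp)
  have "z \<in> subset_sums p A" if z: "z \<in> carrier (Zp p)" for z
  proof -
    have "z - a \<in> residues_of (int p) (ssums (A - {a}))" using full by simp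
    then obtain w where w: "w \<in> ssums (A - {a})" "[z - a = w] (mod int p)"
      unfolding residues_of_def by blast
    then obtain C where C: "C \<subseteq> A - {a}" "w = \<Sum>C" unfolding ssums_def by blast
    have finC: "finite C" by (rule finite_subset[OF C(1)]) (use fin in simp)
    have sub: "insert a C \<subseteq> A" using C(1) a by blast
    have "finsum (Zp p) (\<lambda>x. x) (insert a C) = \<Sum>(insert a C) mod int p"
      by (rule finsum_Zp[OF p]) (use finC sub A(1) in auto)
    also have "\<Sum>(insert a C) = a + w" using C finC by (subst sum.insert) auto
    also have "(a + w) mod int p = z mod int p"
      using cong_add[OF cong_refl[of a] w(2)] by (simp add: cong_def)
    also have "\<dots> = z" using z by (simp add: carrier_Zp)
    finally have "finsum (Zp p) (\<lambda>x. x) (insert a C) = z" .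
    then show ?thesis unfolding subset_sums_def using sub by blast
  qed
  moreover have "subset_sums p A \<subseteq> carrier (Zp p)"
  proof
    fix z assume "z \<in> subset_sums p A"
    then obtain B where B: "B \<subseteq> A" "z = finsum (Zp p) (\<lambda>x. x) B" unfolding subset_sums_def by blast
    have "finite B" by (rule finite_subset[OF B(1) fin])
    then have "z = \<Sum>B mod int p" unfolding B(2) using B(1) A(1) by (intro finsum_Zp[OF p]) auto
    then show "z \<in> carrier (Zp p)" using p by (simp add: carrier_Zp)
  qed
  ultimately have "subset_sums p A = carrier (Zp p)" by blast
  then show False using A(2) unfolding incomplete_def by simp
qed

lemma Zp_norm_mod:
  assumes "0 < p"
  shows "Zp_norm p (x mod int p) = \<bar>cent (int p) x\<bar>"
proof -
  define q where "q = int p"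
  define y where "y = x mod q"
  define h where "h = q div 2"
  have q: "0 < q" using assms by (simp add: q_def)
  have y: "0 \<le> y" "y < q" using q by (simp_all add: y_def)
  have h: "2 * h \<le> q" "q \<le> 2 * h + 1" by (simp_all add: h_def)
  have "cent q x = cent q y" unfolding cent_def y_def by (simp add: mod_add_left_eq)
  moreover have "cent q y = (if y + h < q then y else y - q)"
  proof (cases "y + h < q")
    case True
    have "0 \<le> y + h" using y h q by linarith
    then show ?thesis using True by (simp add: cent_def h_def[symmetric])
  next
    case False
    have "(y + h) mod q = (y + h - q) mod q" by (simp add: mod_diff_right_eq)
    also have "\<dots> = y + h - q" using False y h by (intro mod_pos_pos_trivial) linarith+
    finally show ?thesis using False by (simp add: cent_def h_def[symmetric])
  qed
  ultimately show ?thesis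
    using y h unfolding Zp_norm_def q_def[symmetric] y_def[symmetric] by auto
qed

lemma sum_dilate_norm:
  assumes p: "1 < p" and A: "A \<subseteq> carrier (Zp p)" and u: "[u * b = 1] (mod int p)"
  shows "(\<Sum>a\<in>dilate p b A. Zp_norm p a) = (\<Sum>a\<in>A. \<bar>cent (int p) (b * a)\<bar>)"
proof -
  interpret residues "int p" "Zp p" using p by unfold_locales simp_all
  have d: "dilate p b A = (\<lambda>a. (b * a) mod int p) ` A"
    unfolding dilate_def by (simp add: res_mult_eq)
  have "inj_on (\<lambda>a. (b * a) mod int p) A"
  proof (rule inj_onI)
    fix a c assume ac: "a \<in> A" "c \<in> A" "(b * a) mod int p = (b * c) mod int p"
    then have "[b * a = b * c] (mod int p)" by (simp add: cong_def)
    then have "[a = c] (mod int p)" by (rule cong_mult_cancel[OF u])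
    then show "a = c"
      by (rule cong_small_eq) (use subsetD[OF A ac(1)] subsetD[OF A ac(2)] in \<open>auto simp: carrier_Zp\<close>)
  qed
  then show ?thesis unfolding d using p by (simp add: sum.reindex Zp_norm_mod)
qed

text \<open>The two elements subtracted allow for a possible 0 and for the element set aside for
  incompleteness. Rounding loses little, as \<open>159 / 80 = 1.9875\<close> is just below 1.99, and
  \<open>(159 / 80)^2 > 3.95\<close>.\<close>

lemma size_parameter:
  fixes w :: real and X :: nat
  assumes w: "100 * real X \<le> w" and X: "160000 \<le> X"
  obtains L :: nat where "X \<le> L" "100 * real L \<le> 199 / 100 * w - 2" "395 * w\<^sup>2 \<le> 1000000 * (real L)\<^sup>2"
    "10000 * (real L)\<^sup>2 \<le> 4 * w\<^sup>2"
proof -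
  define L where "L = nat \<lfloor>(199 / 100 * w - 2) / 100\<rfloor>"
  have w0: "16000000 \<le> w" using w X by simp
  have "0 \<le> \<lfloor>(199 / 100 * w - 2) / 100\<rfloor>" using w0 by simp
  then have "real L = of_int \<lfloor>(199 / 100 * w - 2) / 100\<rfloor>" unfolding L_def by simp
  then have L: "real L \<le> (199 / 100 * w - 2) / 100" "(199 / 100 * w - 2) / 100 < real L + 1" by linarith+
  have L1: "100 * real L \<le> 199 / 100 * w - 2" using L(1) by simp
  have "199 / 100 * w - 2 < 100 * real L + 100" using L(2) by simp
  then have L2: "159 / 80 * w \<le> 100 * real L" using w0 by linarith
  have "real X \<le> real L" using L2 w w0 by linarith
  then have "X \<le> L" by simp
  moreover have "395 * w\<^sup>2 \<le> 1000000 * (real L)\<^sup>2"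
  proof -
    have "(159 / 80 * w)\<^sup>2 \<le> (100 * real L)\<^sup>2" using L2 w0 by (intro power_mono) auto
    then have "25281 * w\<^sup>2 \<le> 64000000 * (real L)\<^sup>2" by (simp add: power_mult_distrib power_divide)
    then show ?thesis using zero_le_power2[of w] by linarith
  qed
  moreover have "10000 * (real L)\<^sup>2 \<le> 4 * w\<^sup>2"
  proof -
    have "(100 * real L)\<^sup>2 \<le> (2 * w)\<^sup>2" using L1 w0 by (intro power_mono) auto
    then show ?thesis by (simp add: power_mult_distrib)
  qed
  ultimately show ?thesis using that L1 by blast
qed

theorem theorem1p13:
  shows "\<exists>(C::real) (p0::nat). \<forall>p::nat. prime p \<and> p \<ge> p0 \<longrightarrow>
    (\<forall>A. A \<subseteq> carrier (Zp p) \<and> incomplete p A \<and> real (card A) \<ge> 1.99 * sqrt (real p) \<longrightarrow>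
      (\<exists>b \<in> carrier (Zp p) - {\<zero>\<^bsub>Zp p\<^esub>}.
        real_of_int (\<Sum>a \<in> dilate p b A. Zp_norm p a) \<le> real p + C * sqrt (real p)))"
proof -
  have "cos (pi / 50) < cos 0" by (rule cos_monotone_0_pi) (use pi_gt_zero in auto)
  then have \<kappa>: "0 < 1 - cos (pi / 50)" by simp
  then obtain E :: nat where E: "867 \<le> real E * (1 - cos (pi / 50))"
    using reals_Archimedean3[OF \<kappa>] less_imp_le by blast
  define X where "X = 160000 + 100 * E + 100"
  show ?thesis
  proof (rule exI[of _ 28], rule exI[of _ "(100 * X)\<^sup>2"], intro allI impI)
    fix p :: nat and A
    assume "prime p \<and> (100 * X)\<^sup>2 \<le> p"
      and "A \<subseteq> carrier (Zp p) \<and> incomplete p A \<and> 1.99 * sqrt (real p) \<le> real (card A)"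
    then have p: "prime p" "(100 * X)\<^sup>2 \<le> p" and A: "A \<subseteq> carrier (Zp p)" "incomplete p A" "1.99 * sqrt (real p) \<le> real (card A)"
      by blast+
    define w where "w = sqrt (real p)"
    have w2: "w\<^sup>2 = real p" by (simp add: w_def)
    have "real ((100 * X)\<^sup>2) \<le> real p" using p(2) by (rule of_nat_mono)
    then have "sqrt (real ((100 * X)\<^sup>2)) \<le> w" unfolding w_def by (rule real_sqrt_le_mono)
    then have "\<bar>real (100 * X)\<bar> \<le> w" by (simp only: of_nat_power real_sqrt_abs)
    then have wX: "100 * real X \<le> w" by simp
    have X: "160000 \<le> X" unfolding X_def by simp
    obtain L where L: "X \<le> L" "100 * real L \<le> 199 / 100 * w - 2" "395 * w\<^sup>2 \<le> 1000000 * (real L)\<^sup>2"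
      "10000 * (real L)\<^sup>2 \<le> 4 * w\<^sup>2"
      by (rule size_parameter[OF wX X])
    have p1: "1 < p" by (rule prime_gt_1_nat[OF p(1)])
    have primep: "prime (int p)" using p(1) by simp
    have p0: "0 < int p" using p1 by simp
    have "real (395 * p) \<le> real (1000000 * L\<^sup>2)" using L(3) by (simp add: w2)
    then have L3: "395 * p \<le> 1000000 * L\<^sup>2" by (rule of_nat_le_iff[THEN iffD1])
    have "real (10000 * L\<^sup>2) \<le> real (4 * p)" using L(4) by (simp add: w2)
    then have L4: "10000 * L\<^sup>2 \<le> 4 * p" by (rule of_nat_le_iff[THEN iffD1])
    have L1: "160000 \<le> L" "100 * E + 100 \<le> L" using L(1) unfolding X_def by linarith+
    \<comment> \<open>Zero has norm 0, and the greedy growth needs elements that are nonzero modulo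
      \<open>p\<close>.\<close>
    define A' where "A' = A - {0}"
    have finA: "finite A" using A(1) finite_subset by (auto simp: carrier_Zp)
    have A'sub: "A' \<subseteq> {1..<int p}"
    proof
      fix x assume "x \<in> A'"
      then have "x \<in> {0..<int p}" "x \<noteq> 0" using A(1) unfolding A'_def carrier_Zp by auto
      then show "x \<in> {1..<int p}" by simp
    qed
    have "card A \<le> card A' + 1" unfolding A'_def using card_Suc_Diff1[OF finA, of 0] by (cases "0 \<in> A") auto
    moreover have "199 / 100 * w \<le> real (card A)" using A(3) by (simp add: w_def)
    ultimately have cA': "100 * L + 1 \<le> card A'" using L(2) by linarith
    have inc: "residues_of (int p) (ssums (A' - {a})) \<noteq> UNIV" if a: "a \<in> A'" for a
    proof -
      have "residues_of (int p) (ssums (A - {a})) \<noteq> UNIV"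
        by (rule incomplete_remove[OF p1 A(1,2)]) (use a in \<open>simp add: A'_def\<close>)
      moreover have "residues_of (int p) (ssums (A' - {a})) \<subseteq> residues_of (int p) (ssums (A - {a}))"
        unfolding A'_def by (intro residues_of_mono ssums_mono) blast
      ultimately show ?thesis by blast
    qed
    \<comment> \<open>Without \<open>a1\<close> the set is incomplete even when the empty sum is
      allowed.\<close>
    obtain a1 where a1: "a1 \<in> A'" using cA' by (metis card.empty ex_in_conv not_one_le_zero trans_le_add2 add_leD2)
    have "finite A'" unfolding A'_def using finA by simp
    then have "Suc (card (A' - {a1})) = card A'" by (rule card_Suc_Diff1[OF _ a1])
    then have "100 * L \<le> card (A' - {a1})" using cA' by simp
    then obtain A0 where A0: "A0 \<subseteq> A' - {a1}" "card A0 = 100 * L"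
      by (rule obtain_subset_with_card_n)
    have A0p: "A0 \<subseteq> {1..<int p}" using A0(1) A'sub by blast
    have A0inc: "residues_of (int p) (ssums A0) \<noteq> UNIV"
      using inc[OF a1] residues_of_mono[OF ssums_mono[OF A0(1)], of "int p"] by blast
    have L34: "395 * nat (int p) \<le> 1000000 * L\<^sup>2" "10000 * L\<^sup>2 \<le> 4 * nat (int p)" using L3 L4 by simp_all
    obtain \<beta> R M \<rho> where \<beta>: "\<beta> \<in> {1..<int p}" and R: "R \<subseteq> A0" "\<forall>x\<in>R. \<bar>cent (int p) (\<beta> * x)\<bar> \<le> M"
      and M: "0 \<le> M" "77 * M \<le> 49 * int \<rho>" and \<rho>: "75 * L \<le> \<rho>" "\<rho> \<le> 95 * L" "\<rho> \<le> card R + E"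
      using exists_dilation[OF primep A0p A0(2) L1(1) L34 E L1(2) A0inc] by blast
    obtain u where "[\<beta> * u = 1] (mod int p)" by (rule prime_invertible[OF primep not_dvd_residue[OF \<beta>]])
    then have u: "[u * \<beta> = 1] (mod int p)" by (simp add: mult.commute)
    have "395 * int p \<le> 1000000 * (int L)\<^sup>2"
    proof -
      have "int (395 * p) \<le> int (1000000 * L\<^sup>2)" using L3 by (simp only: of_nat_le_iff)
      then show ?thesis by simp
    qed
    then have pL: "int p \<le> 2532 * (int L)\<^sup>2" using zero_le_power2[of "int L"] by linarith
    have RA': "R \<subseteq> A'" using R(1) A0(1) by blast
    have bound: "(\<Sum>a\<in>A'. \<bar>cent (int p) (\<beta> * a)\<bar>) \<le> int p + 13 * M + 12"
      by (rule norm_sum_bound[OF p0 pL u A'sub RA' _ M \<rho> L1(2) inc]) (use R(2) in blast)+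
    have "(\<Sum>a\<in>A. \<bar>cent (int p) (\<beta> * a)\<bar>) = (\<Sum>a\<in>A'. \<bar>cent (int p) (\<beta> * a)\<bar>)"
    proof (rule sum.mono_neutral_right[OF finA])
      have "cent (int p) (\<beta> * 0) = 0" by (rule cent_eqI[OF p0]) (use p0 in simp_all)
      then show "\<forall>a\<in>A - A'. \<bar>cent (int p) (\<beta> * a)\<bar> = 0" unfolding A'_def by auto
    qed (auto simp: A'_def)
    then have total: "(\<Sum>a\<in>dilate p \<beta> A. Zp_norm p a) \<le> int p + 13 * M + 12"
      using bound sum_dilate_norm[OF p1 A(1) u] by simp
    have "77 * M \<le> 4655 * int L" using M(2) \<rho>(2) by linarith
    then have "77 * real_of_int M \<le> 4655 * real L" by linarith
    \<comment> \<open>Since \<open>M \<le> 4655 / 77 * L\<close> and \<open>L < 0.0199 * w\<close>,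
      the left side is below \<open>16 * w\<close>; the constant 28 is generous.\<close>
    then have "13 * real_of_int M + 12 \<le> 28 * w" using L(2) wX X by linarith
    moreover have "real_of_int (\<Sum>a\<in>dilate p \<beta> A. Zp_norm p a) \<le> real p + 13 * real_of_int M + 12"
      using total by linarith
    ultimately have "real_of_int (\<Sum>a\<in>dilate p \<beta> A. Zp_norm p a) \<le> real p + 28 * sqrt (real p)"
      unfolding w_def by linarith
    moreover have "\<beta> \<in> carrier (Zp p) - {\<zero>\<^bsub>Zp p\<^esub>}"
    proof -
      interpret residues "int p" "Zp p" using p1 by unfold_locales simp_all
      show ?thesis using \<beta> by (simp add: carrier_Zp res_zero_eq)
    qed
    ultimately show "\<exists>b\<in>carrier (Zp p) - {\<zero>\<^bsub>Zp p\<^esub>}.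
        real_of_int (\<Sum>a\<in>dilate p b A. Zp_norm p a) \<le> real p + 28 * sqrt (real p)" by blast
  qed
qed

end
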